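(* Let $\Xi=\mathbb R^{n_\xi}$, let $\hat\xi_1,\dots,\hat\xi_N\in\mathbb R^{n_\xi}$ be samples, $\theta>0$, $\varepsilon,\beta,\alpha\in(0,1)$, and let the matrices $W_a,W_d,\bar V_a,\bar A_s,\bar B_s$ be as in the context. For symmetric $\bar P,Q,\bar M$ and scalars $\alpha_1,\alpha_2$, denote by $(\star)$ the constraints $$\bar M\succ0,\quad \alpha_1+\alpha_2\ge\alpha,\quad 0\le\alpha_1\le1,\quad 0\le\alpha_2\le1,\quad \begin{bmatrix}\alpha\bar M&0&\bar A_s^\top\bar M\\0&\bar\Omega&\bar B_s^\top\bar M\\\bar M\bar A_s&\bar M\bar B_s&\bar M\end{bmatrix}\succeq0,$$ where $\bar\Omega={\rm diag}\{(1-\alpha_1)\bar V_a^\top W_a^\top\bar PW_a\bar V_a,(1-\alpha_2)Q\}$. Consider the distributionally robust attack detector design problem $$\min_{\bar P\succ0,\,Q\succ0,\,\bar M\succ0,\,\alpha_1,\alpha_2}\ -\log\det(\bar M)\quad\text{s.t.}\quad \sup_{\mathbb P\in\mathcal D_{\rm W}(\theta;N)}\mathbb P\{\xi^\top W_d^\top\bar PW_d\xi>1\}\le\varepsilon,\quad \sup_{\mathbb P\in\mathcal D_{\rm W}(\theta;N)}\mathbb P\{\xi^\top Q\xi>1\}\le1-\beta,\quad(\star).$$ This problem admits the following exact reformulation (that is, $(\bar P,Q,\bar M,\alpha_1,\alpha_2)$ is feasible for the problem above if and only if it can be completed by auxiliary variables to a feasible point of the problem below, the objectives being identical): minimize $-\log\det(\bar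 M)$ over $\bar P,\bar M,Q,\alpha_1,\alpha_2,\gamma,\lambda$ and $y_i,v_i,\tau_i,\pi_i,t_i,u_i,p_i,q_i\in\mathbb R$ ($i=1,\dots,N$) subject to $\bar P\succ0$, $Q\succ0$, $(\star)$, $$\lambda\ge0,\quad \theta+\frac1N\sum_{i=1}^Ny_i\le\lambda\varepsilon,\qquad \gamma\ge0,\quad \theta+\frac1N\sum_{i=1}^Nv_i\le(1-\beta)\gamma,$$ and, for all $i=1,\dots,N$, $$y_i\ge0,\quad \tau_i\ge0,\quad y_i\ge\lambda-t_i,\quad \begin{bmatrix}I&-\hat\xi_i\\-\hat\xi_i^\top&\hat\xi_i^\top\hat\xi_i-q_i\end{bmatrix}-\tau_i\begin{bmatrix}W_d^\top\bar PW_d&0\\0&-1\end{bmatrix}\succeq0,\quad \begin{bmatrix}q_i&t_i\\ t_i&1\end{bmatrix}\succeq0,$$ $$v_i\ge0,\quad \pi_i\ge0,\quad v_i\ge\gamma-u_i,\quad \begin{bmatrix}I&-\hat\xi_i\\-\hat\xi_i^\top&\hat\xi_i^\top\hat\xi_i-p_i\end{bmatrix}-\pi_i\begin{bmatrix}Q&0\\0&-1\end{bmatrix}\succeq0,\quad \begin{bmatrix}p_i&u_i\\ u_i&1\end{bmatrix}\succeq0.$$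
   Context: Wasserstein ambiguity set: for probability distributions $\mathbb P,\mathbb P'$ on $\Xi$, $d_{\rm W}(\mathbb P,\mathbb P')=\inf_{\mathbb Q}\mathbb E_{\mathbb Q}\{\|\xi-\xi'\|\}$, the infimum over all joint distributions $\mathbb Q$ of $(\xi,\xi')$ with marginals $\mathbb P,\mathbb P'$, and $\|\cdot\|$ the Euclidean norm. With $\hat{\mathbb P}_N=\frac1N\sum_{i=1}^N\delta_{\hat\xi_i}$, $\mathcal D_{\rm W}(\theta;N)$ is the set of all probability distributions $\mathbb P$ on $\Xi$ with $d_{\rm W}(\mathbb P,\hat{\mathbb P}_N)\le\theta$. Data matrices. Plant: $x(k+1)=Ax(k)+Bu^a(k)+B_dd(k)$, $y(k)=Cx(k)+D_dd(k)$, with $x\in\mathbb R^{n_x}$, $y\in\mathbb R^{n_y}$, $u^a\in\mathbb R^{n_u}$, $d\in\mathbb R^{n_d}$, $(A,C)$ observable, $(A,B)$ controllable. Attack $a(k)\in\mathbb R^{n_a}$, $n_a=n_u+n_y$: $u^a=u+B_aa$, $y^a=y+D_aa$. Controller: $x_c(k+1)=A_cx_c(k)+B_c[y_{\rm ref}(k)-y^a(k)]$, $u(k)=C_cx_c(k)+D_c[y_{\rm ref}(k)-y^a(k)]$, $x_c\in\mathbb R^{n_c}$. Closed-loop matrices: $$\bar A=\begin{bmatrix}A-BD_cC&BC_c\\-B_cC&A_c\end{bmatrix},\quad \bar B_a=\begin{bmatrix}B(B_a-D_cD_a)\\-B_cD_a\end{bmatrix},\quad \bar B_d=\begin{bmatrix}B_d-BD_cD_d\\-B_cD_d\end{bmatrix}.$$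 Fix $s\ge n_x$ and let $n_\xi=sn_d$ ($\xi$ is the stacked disturbance over $s$ steps). $\Gamma_s=[C^\top\ (CA)^\top\cdots(CA^{s-1})^\top]^\top$; $\Gamma_s^\perp\in\mathbb R^{(sn_y-n_x)\times sn_y}$ has full row rank with $\Gamma_s^\perp\Gamma_s=0$. $H_{d,s}$ is the $s\times s$ block lower-triangular Toeplitz matrix with diagonal blocks $D_d$ and $(i,j)$ block $CA^{i-j-1}B_d$ for $i>j$; $H_{a,s}$ is the same with $(B_d,D_d)$ replaced by $(BB_a,D_a)$. $W_d=\Gamma_s^\perp H_{d,s}$, $W_a=\Gamma_s^\perp H_{a,s}$; $W_a$ is assumed to have full row rank. From a singular value decomposition $W_a=U_a\Lambda V_a^\top$ (nonzero singular values first), $\bar V_a$ consists of the first $sn_y-n_x$ columns of $V_a$. $\bar A_s$ is the $s\times s$ block matrix whose last block column is $[\bar A^\top,(\bar A^2)^\top,\dots,(\bar A^s)^\top]^\top$, other blocks zero; $\bar B_{a,s}$ is the $s\times s$ block lower-triangular matrix with $(i,j)$ block $\bar A^{i-j}\bar B_a$ for $i\ge j$; $\bar B_{d,s}$ is the same with $\bar B_d$. $\bar B_s=\begin{bmatrix}\bar B_{a,s}\bar V_a&\ \bar B_{d,s}-\bar B_{a,s}W_a^\dagger W_d\end{bmatrix}$, with $\dagger$ the Moore-Penrose inverse. In the paper $\bar M=\frac{2-\alpha}{1-\alpha}M$, where $M$ is the shape matrix of an ellipsoid; $M$ is determined by $\bar M$ and plays no further role here. *)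

theory Defs
  imports
    "HOL-Probability.Probability"
    "Jordan_Normal_Form.Matrix"
    "Jordan_Normal_Form.Determinant"
    "Jordan_Normal_Form.DL_Rank"
begin

no_notation inner (infix "\<bullet>" 70)
no_notation vec_nth (infixl "$" 90)

section \<open>Matrices\<close>

text \<open>Dimensions are natural numbers given by carriers; all indices are zero-based.\<close>

definition append_cols :: "'a::zero mat \<Rightarrow> 'a mat \<Rightarrow> 'a mat" (infixr "@\<^sub>c" 66) where
  "A @\<^sub>c B = four_block_mat A B (0\<^sub>m 0 (dim_col A)) (0\<^sub>m 0 (dim_col B))"

text \<open>A \<open>p \<times> q\<close> array of blocks, each block being \<open>nr \<times> nc\<close>.\<close>

definition block_mat :: "nat \<Rightarrow> nat \<Rightarrow> nat \<Rightarrow> nat \<Rightarrow> (nat \<Rightarrow> nat \<Rightarrow> 'a mat) \<Rightarrow> 'a mat" where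
  "block_mat p q nr nc F =
     mat (p * nr) (q * nc) (\<lambda>(i, j). F (i div nr) (j div nc) $$ (i mod nr, j mod nc))"

definition psd :: "nat \<Rightarrow> real mat \<Rightarrow> bool" where
  "psd n X \<longleftrightarrow> X \<in> carrier_mat n n \<and> X\<^sup>T = X \<and> (\<forall>v \<in> carrier_vec n. v \<bullet> (X *\<^sub>v v) \<ge> 0)"

definition pos_def :: "nat \<Rightarrow> real mat \<Rightarrow> bool" where
  "pos_def n X \<longleftrightarrow> X \<in> carrier_mat n n \<and> X\<^sup>T = X \<and>
     (\<forall>v \<in> carrier_vec n. v \<noteq> 0\<^sub>v n \<longrightarrow> v \<bullet> (X *\<^sub>v v) > 0)"

definition full_row_rank :: "real mat \<Rightarrow> bool" where
  "full_row_rank X \<longleftrightarrow> vec_space.rank (dim_row X) X = dim_row X"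

definition is_moore_penrose :: "real mat \<Rightarrow> real mat \<Rightarrow> bool" where
  "is_moore_penrose A X \<longleftrightarrow> X \<in> carrier_mat (dim_col A) (dim_row A) \<and>
     A * X * A = A \<and> X * A * X = X \<and> (A * X)\<^sup>T = A * X \<and> (X * A)\<^sup>T = X * A"

text \<open>\<open>W = U \<Lambda> V\<^sup>T\<close> with full-size orthogonal factors, the nonzero singular values coming first.\<close>

definition is_svd :: "real mat \<Rightarrow> real mat \<Rightarrow> real mat \<Rightarrow> real mat \<Rightarrow> bool" where
  "is_svd W U L V \<longleftrightarrow>
     (let m = dim_row W; n = dim_col W in
       U \<in> carrier_mat m m \<and> U\<^sup>T * U = 1\<^sub>m m \<and>
       V \<in> carrier_mat n n \<and> V\<^sup>T * V = 1\<^sub>m n \<and>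
       L \<in> carrier_mat m n \<and>
       (\<forall>i<m. \<forall>j<n. i \<noteq> j \<longrightarrow> L $$ (i, j) = 0) \<and>
       (\<forall>i<min m n. L $$ (i, i) \<ge> 0) \<and>
       (\<forall>i<min m n. \<forall>j<i. L $$ (i, i) \<noteq> 0 \<longrightarrow> L $$ (j, j) \<noteq> 0) \<and>
       W = U * L * V\<^sup>T)"

definition first_cols :: "nat \<Rightarrow> 'a mat \<Rightarrow> 'a mat" where
  "first_cols r V = mat (dim_row V) r (\<lambda>(i, j). V $$ (i, j))"


section \<open>System matrices\<close>

definition obs_mat :: "nat \<Rightarrow> real mat \<Rightarrow> real mat \<Rightarrow> real mat" where
  "obs_mat s A C = block_mat s 1 (dim_row C) (dim_row A) (\<lambda>i _. C * A ^\<^sub>m i)"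

definition ctrb_mat :: "nat \<Rightarrow> real mat \<Rightarrow> real mat \<Rightarrow> real mat" where
  "ctrb_mat s A B = block_mat 1 s (dim_row A) (dim_col B) (\<lambda>_ j. A ^\<^sub>m j * B)"

definition observable :: "real mat \<Rightarrow> real mat \<Rightarrow> bool" where
  "observable A C \<longleftrightarrow>
     (let n = dim_row A in vec_space.rank (n * dim_row C) (obs_mat n A C) = n)"

definition controllable :: "real mat \<Rightarrow> real mat \<Rightarrow> bool" where
  "controllable A B \<longleftrightarrow>
     (let n = dim_row A in vec_space.rank n (ctrb_mat n A B) = n)"

definition toeplitz_mat :: "nat \<Rightarrow> real mat \<Rightarrow> real mat \<Rightarrow> real mat \<Rightarrow> real mat \<Rightarrow> real mat" where
  "toeplitz_mat s A B C D = block_mat s s (dim_row D) (dim_col D)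
     (\<lambda>i j. if i = j then D
            else if j < i then C * A ^\<^sub>m (i - j - 1) * B
            else 0\<^sub>m (dim_row D) (dim_col D))"

definition cl_A :: "real mat \<Rightarrow> real mat \<Rightarrow> real mat \<Rightarrow> real mat \<Rightarrow> real mat \<Rightarrow> real mat \<Rightarrow> real mat \<Rightarrow> real mat" where
  "cl_A A B C Ac Bc Cc Dc = four_block_mat (A - B * Dc * C) (B * Cc) (- (Bc * C)) Ac"

definition cl_Ba :: "real mat \<Rightarrow> real mat \<Rightarrow> real mat \<Rightarrow> real mat \<Rightarrow> real mat \<Rightarrow> real mat" where
  "cl_Ba B Ba Da Bc Dc = (B * (Ba - Dc * Da)) @\<^sub>r (- (Bc * Da))"

definition cl_Bd :: "real mat \<Rightarrow> real mat \<Rightarrow> real mat \<Rightarrow> real mat \<Rightarrow> real mat \<Rightarrow> real mat" where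
  "cl_Bd B Bd Dd Bc Dc = (Bd - B * Dc * Dd) @\<^sub>r (- (Bc * Dd))"

definition lifted_A :: "nat \<Rightarrow> real mat \<Rightarrow> real mat" where
  "lifted_A s A = (let m = dim_row A in
     block_mat s s m m (\<lambda>i j. if Suc j = s then A ^\<^sub>m (Suc i) else 0\<^sub>m m m))"

definition lifted_B :: "nat \<Rightarrow> real mat \<Rightarrow> real mat \<Rightarrow> real mat" where
  "lifted_B s A B = block_mat s s (dim_row B) (dim_col B)
     (\<lambda>i j. if j \<le> i then A ^\<^sub>m (i - j) * B else 0\<^sub>m (dim_row B) (dim_col B))"


section \<open>Distributions on Euclidean space and the Wasserstein ball\<close>

text \<open>The Borel \<open>\<sigma>\<close>-algebra of Euclidean \<open>n\<close>-space, transported to \<open>carrier_vec n\<close> along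
  the coordinates.\<close>

definition borel_vec :: "nat \<Rightarrow> real vec measure" where
  "borel_vec n = vimage_algebra (carrier_vec n) (\<lambda>v. \<lambda>i\<in>{..<n}. v $ i) (PiM {..<n} (\<lambda>_. borel))"

lemma space_borel_vec [simp]: "space (borel_vec n) = carrier_vec n"
  by (simp add: borel_vec_def)

lemma measurable_borel_vec_nth [measurable]:
  assumes "i < n"
  shows "(\<lambda>v. v $ i) \<in> borel_measurable (borel_vec n)"
proof -
  have "(\<lambda>v. \<lambda>i\<in>{..<n}. v $ i) \<in> carrier_vec n \<rightarrow> space (PiM {..<n} (\<lambda>_. borel :: real measure))"
    by (auto simp: space_PiM)
  then have "(\<lambda>v. \<lambda>i\<in>{..<n}. v $ i) \<in> measurable (borel_vec n) (PiM {..<n} (\<lambda>_. borel :: real measure))"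
    unfolding borel_vec_def by (rule measurable_vimage_algebra1)
  from measurable_compose[OF this measurable_component_singleton[of i]] assms
  show ?thesis by simp
qed

definition euclid_norm :: "real vec \<Rightarrow> real" where
  "euclid_norm v = sqrt (v \<bullet> v)"

definition prob_measures :: "nat \<Rightarrow> real vec measure set" where
  "prob_measures n = {P. prob_space P \<and> sets P = sets (borel_vec n)}"

definition couplings :: "nat \<Rightarrow> real vec measure \<Rightarrow> real vec measure \<Rightarrow> (real vec \<times> real vec) measure set" where
  "couplings n P P' = {Q. prob_space Q \<and> sets Q = sets (borel_vec n \<Otimes>\<^sub>M borel_vec n) \<and>
     distr Q (borel_vec n) fst = P \<and> distr Q (borel_vec n) snd = P'}"

text \<open>The distance is \<open>\<infinity>\<close> where no coupling has finite cost.\<close>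

definition wasserstein :: "nat \<Rightarrow> real vec measure \<Rightarrow> real vec measure \<Rightarrow> ennreal" where
  "wasserstein n P P' =
     (INF Q \<in> couplings n P P'. \<integral>\<^sup>+ (\<xi>, \<xi>'). ennreal (euclid_norm (\<xi> - \<xi>')) \<partial>Q)"

text \<open>The empirical distribution as the law of a uniformly chosen sample; the next lemma shows
  that it is the average of the Dirac measures.\<close>

definition empirical :: "nat \<Rightarrow> nat \<Rightarrow> (nat \<Rightarrow> real vec) \<Rightarrow> real vec measure" where
  "empirical n N \<xi>s = distr (uniform_count_measure {..<N}) (borel_vec n) \<xi>s"

lemma emeasure_empirical:
  assumes "N \<ge> 1" and "\<And>i. i < N \<Longrightarrow> \<xi>s i \<in> carrier_vec n" and "E \<in> sets (borel_vec n)"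
  shows "emeasure (empirical n N \<xi>s) E = ennreal (1 / real N * (\<Sum>i<N. indicator E (\<xi>s i)))"
proof -
  have m: "\<xi>s \<in> measurable (uniform_count_measure {..<N}) (borel_vec n)"
    using assms(2)
    by (auto simp: measurable_def space_uniform_count_measure sets_uniform_count_measure)
  have "emeasure (empirical n N \<xi>s) E
      = emeasure (uniform_count_measure {..<N}) (\<xi>s -` E \<inter> {..<N})"
    unfolding empirical_def
    by (subst emeasure_distr[OF m assms(3)]) (simp add: space_uniform_count_measure)
  also have "\<dots> = ennreal (real (card (\<xi>s -` E \<inter> {..<N})) / real N)"
    using assms(1) by (subst emeasure_uniform_count_measure) (auto simp: lessThan_empty_iff)
  also have "real (card (\<xi>s -` E \<inter> {..<N})) = (\<Sum>i<N. indicator E (\<xi>s i))"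
    by (simp add: indicator_def sum.If_cases vimage_def Int_commute)
  finally show ?thesis by simp
qed

definition wasserstein_ball :: "nat \<Rightarrow> real \<Rightarrow> nat \<Rightarrow> (nat \<Rightarrow> real vec) \<Rightarrow> real vec measure set" where
  "wasserstein_ball n \<theta> N \<xi>s =
     {P \<in> prob_measures n. wasserstein n P (empirical n N \<xi>s) \<le> ennreal \<theta>}"

definition worst_case_prob :: "nat \<Rightarrow> real \<Rightarrow> nat \<Rightarrow> (nat \<Rightarrow> real vec) \<Rightarrow> real mat \<Rightarrow> ennreal" where
  "worst_case_prob n \<theta> N \<xi>s S =
     (SUP P \<in> wasserstein_ball n \<theta> N \<xi>s. emeasure P {\<xi> \<in> carrier_vec n. \<xi> \<bullet> (S *\<^sub>v \<xi>) > 1})"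


section \<open>The two optimization problems\<close>

definition star_constraints :: "real \<Rightarrow> real mat \<Rightarrow> real mat \<Rightarrow> real mat \<Rightarrow> real mat \<Rightarrow>
    real mat \<Rightarrow> real mat \<Rightarrow> real mat \<Rightarrow> real \<Rightarrow> real \<Rightarrow> bool" where
  "star_constraints \<alpha> As Bs Va Wa P Q M \<alpha>1 \<alpha>2 \<longleftrightarrow>
     (let m = dim_row As;
          \<Omega> = diag_block_mat [(1 - \<alpha>1) \<cdot>\<^sub>m (Va\<^sup>T * Wa\<^sup>T * P * Wa * Va), (1 - \<alpha>2) \<cdot>\<^sub>m Q];
          k = dim_row \<Omega>
      in pos_def m M \<and> \<alpha>1 + \<alpha>2 \<ge> \<alpha> \<and> 0 \<le> \<alpha>1 \<and> \<alpha>1 \<le> 1 \<and> 0 \<le> \<alpha>2 \<and> \<alpha>2 \<le> 1 \<and>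
         psd (m + k + m)
           ((\<alpha> \<cdot>\<^sub>m M   @\<^sub>c 0\<^sub>m m k  @\<^sub>c As\<^sup>T * M) @\<^sub>r
            (0\<^sub>m k m   @\<^sub>c \<Omega>       @\<^sub>c Bs\<^sup>T * M) @\<^sub>r
            (M * As   @\<^sub>c M * Bs  @\<^sub>c M)))"

type_synonym design = "real mat \<times> real mat \<times> real mat \<times> real \<times> real"

type_synonym aux = "real \<times> real \<times> (nat \<Rightarrow> real) \<times> (nat \<Rightarrow> real) \<times> (nat \<Rightarrow> real) \<times> (nat \<Rightarrow> real) \<times>
  (nat \<Rightarrow> real) \<times> (nat \<Rightarrow> real) \<times> (nat \<Rightarrow> real) \<times> (nat \<Rightarrow> real)"

definition dro_feasible :: "real \<Rightarrow> nat \<Rightarrow> (nat \<Rightarrow> real vec) \<Rightarrow> real \<Rightarrow> real \<Rightarrow> real \<Rightarrow>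
    real mat \<Rightarrow> real mat \<Rightarrow> real mat \<Rightarrow> real mat \<Rightarrow> real mat \<Rightarrow> design set" where
  "dro_feasible \<theta> N \<xi>s \<epsilon> \<beta> \<alpha> Wa Wd Va As Bs = {(P, Q, M, \<alpha>1, \<alpha>2).
     (let n = dim_col Wd in
       pos_def (dim_row Wd) P \<and> pos_def n Q \<and> pos_def (dim_row As) M \<and>
       worst_case_prob n \<theta> N \<xi>s (Wd\<^sup>T * P * Wd) \<le> ennreal \<epsilon> \<and>
       worst_case_prob n \<theta> N \<xi>s Q \<le> ennreal (1 - \<beta>) \<and>
       star_constraints \<alpha> As Bs Va Wa P Q M \<alpha>1 \<alpha>2)}"

definition dro_objective :: "design \<Rightarrow> real" where
  "dro_objective = (\<lambda>(P, Q, M, \<alpha>1, \<alpha>2). - ln (det M))"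

abbreviation scalar_mat :: "real \<Rightarrow> real mat" where
  "scalar_mat c \<equiv> mat 1 1 (\<lambda>_. c)"

definition sample_lmi :: "nat \<Rightarrow> real vec \<Rightarrow> real \<Rightarrow> real \<Rightarrow> real mat \<Rightarrow> bool" where
  "sample_lmi n \<xi> q \<tau> S \<longleftrightarrow> psd (n + 1)
     (((1\<^sub>m n                    @\<^sub>c - mat_of_cols n [\<xi>]) @\<^sub>r
       (- mat_of_rows n [\<xi>]      @\<^sub>c scalar_mat (\<xi> \<bullet> \<xi> - q)))
      - \<tau> \<cdot>\<^sub>m ((S         @\<^sub>c 0\<^sub>m n 1) @\<^sub>r
               (0\<^sub>m 1 n   @\<^sub>c scalar_mat (- 1))))"

definition hyp_lmi :: "real \<Rightarrow> real \<Rightarrow> bool" where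
  "hyp_lmi q t \<longleftrightarrow> psd 2 (mat_of_rows_list 2 [[q, t], [t, 1]])"

definition sdp_feasible :: "real \<Rightarrow> nat \<Rightarrow> (nat \<Rightarrow> real vec) \<Rightarrow> real \<Rightarrow> real \<Rightarrow> real \<Rightarrow>
    real mat \<Rightarrow> real mat \<Rightarrow> real mat \<Rightarrow> real mat \<Rightarrow> real mat \<Rightarrow> (design \<times> aux) set" where
  "sdp_feasible \<theta> N \<xi>s \<epsilon> \<beta> \<alpha> Wa Wd Va As Bs =
     {((P, Q, M, \<alpha>1, \<alpha>2), (\<gamma>, lam, y, v, \<tau>, \<pi>, t, u, p, q)).
     (let n = dim_col Wd in
       pos_def (dim_row Wd) P \<and> pos_def n Q \<and>
       star_constraints \<alpha> As Bs Va Wa P Q M \<alpha>1 \<alpha>2 \<and>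
       lam \<ge> 0 \<and> \<theta> + 1 / real N * (\<Sum>i<N. y i) \<le> lam * \<epsilon> \<and>
       \<gamma> \<ge> 0 \<and> \<theta> + 1 / real N * (\<Sum>i<N. v i) \<le> (1 - \<beta>) * \<gamma> \<and>
       (\<forall>i<N. y i \<ge> 0 \<and> \<tau> i \<ge> 0 \<and> y i \<ge> lam - t i \<and>
          sample_lmi n (\<xi>s i) (q i) (\<tau> i) (Wd\<^sup>T * P * Wd) \<and> hyp_lmi (q i) (t i) \<and>
          v i \<ge> 0 \<and> \<pi> i \<ge> 0 \<and> v i \<ge> \<gamma> - u i \<and>
          sample_lmi n (\<xi>s i) (p i) (\<pi> i) Q \<and> hyp_lmi (p i) (u i)))}"

definition sdp_objective :: "design \<times> aux \<Rightarrow> real" where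
  "sdp_objective = (\<lambda>((P, Q, M, \<alpha>1, \<alpha>2), _). - ln (det M))"

text \<open>\<open>F, f\<close> and \<open>G, g\<close> are the feasible sets and objectives of two minimization problems, the
  second having auxiliary variables in addition to those of the first.\<close>

definition exact_reformulation ::
    "'a set \<Rightarrow> ('a \<Rightarrow> real) \<Rightarrow> ('a \<times> 'b) set \<Rightarrow> ('a \<times> 'b \<Rightarrow> real) \<Rightarrow> bool" where
  "exact_reformulation F f G g \<longleftrightarrow>
     (\<forall>x. x \<in> F \<longleftrightarrow> (\<exists>z. (x, z) \<in> G)) \<and> (\<forall>x z. g (x, z) = f x)"

end

theory Submission
  imports Defs
begin

text \<open>
  The plant, the attack and the controller enter both problems only through \<open>W\<^sub>d\<close> and the
  constraints \<open>(\<star>)\<close>, which the two problems share. What has to be proved is therefore a statement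
  about a single chance constraint: for symmetric \<open>S\<close>, the worst-case probability of the
  exceedance event \<open>E = {\<xi>. \<xi>\<^sup>T S \<xi> > 1}\<close> over the Wasserstein ball is at most \<open>\<epsilon>\<close> iff the block of
  constraints on \<open>\<lambda>, y, \<tau>, t, q\<close> is solvable. It is applied once with \<open>S = W\<^sub>d\<^sup>T P W\<^sub>d\<close>
  and once with \<open>S = Q\<close>.

  The matrix inequality for the sample \<open>\<xi>\<^sub>i\<close> says that \<open>E\<close> keeps distance at least \<open>sqrt q\<^sub>i\<close> (\<open>q\<^sub>i \<ge> 0\<close>) from
  \<open>\<xi>\<^sub>i\<close>. That it implies this is immediate; that some multiplier \<open>\<tau>\<^sub>i\<close> witnesses every true bound
  of this kind is the S-lemma, proved below in an elementary way
  (\<open>sample_lmi_bound\<close>, \<open>sample_lmi_complete\<close>). The \<open>2 \<times> 2\<close> inequality says \<open>t\<^sub>i\<^sup>2 \<le> q\<^sub>i\<close>, so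
  that \<open>t\<^sub>i\<close> is a lower bound of the distance \<open>d\<^sub>i\<close> from \<open>\<xi>\<^sub>i\<close> to \<open>E\<close>, and \<open>t\<^sub>i = d\<^sub>i\<close> is the best choice;
  if \<open>E\<close> is empty, \<open>d\<^sub>i = \<infinity>\<close> and \<open>t\<^sub>i\<close> can be as large as needed.

  With these distances the claim becomes a duality: the worst-case probability is at most \<open>\<epsilon>\<close> iff
  some \<open>\<lambda> \<ge> 0\<close> has \<open>\<theta> + (1/N) \<Sum> max 0 (\<lambda> - d\<^sub>i) \<le> \<lambda> \<epsilon>\<close>. Given \<open>\<lambda>\<close>, integrating the pointwise bound
  \<open>\<lambda> 1\<^sub>E(\<xi>) \<le> y\<^sub>i + |\<xi> - \<xi>\<^sub>i|\<close> against an arbitrary coupling bounds \<open>\<lambda> P(E)\<close> (\<open>coupling_bound\<close>).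
  Conversely, moving mass from the samples closest to \<open>E\<close> into \<open>E\<close> first is optimal; if no \<open>\<lambda>\<close>
  works, this greedy plan carries a mass greater than \<open>\<epsilon>\<close> at a cost below \<open>\<theta>\<close>
  (\<open>fractional_quantile\<close>). The strict inequality leaves room for stopping at points of \<open>E\<close>
  whose distances only approximate the infima \<open>d\<^sub>i\<close>, so that the resulting distribution lies in the
  ball and violates the constraint (\<open>transport_to_targets\<close>).
\<close>


section \<open>Quadratic forms and the S-lemma\<close>

lemma scalar_prod_self_nonneg: "0 \<le> v \<bullet> (v :: real vec)"
  by (simp add: scalar_prod_def sum_nonneg)

lemma euclid_norm_nonneg [simp]: "0 \<le> euclid_norm v"
  by (auto simp: euclid_norm_def scalar_prod_def intro!: sum_nonneg)

lemma euclid_norm_square: "(euclid_norm v)\<^sup>2 = v \<bullet> v"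
  by (simp add: euclid_norm_def scalar_prod_self_nonneg)

definition quad :: "real mat \<Rightarrow> real vec \<Rightarrow> real" where
  "quad X v = v \<bullet> (X *\<^sub>v v)"

lemma quad_line:
  assumes X: "X \<in> carrier_mat m m" and u: "u \<in> carrier_vec m" and v: "v \<in> carrier_vec m"
  shows "quad X (u + s \<cdot>\<^sub>v v) = quad X v * s\<^sup>2 + (u \<bullet> (X *\<^sub>v v) + v \<bullet> (X *\<^sub>v u)) * s + quad X u"
proof -
  have Xu: "X *\<^sub>v u \<in> carrier_vec m" and Xv: "X *\<^sub>v v \<in> carrier_vec m"
    using X u v by auto
  have "X *\<^sub>v (u + s \<cdot>\<^sub>v v) = X *\<^sub>v u + s \<cdot>\<^sub>v (X *\<^sub>v v)"
    using X u v by (simp add: mult_add_distrib_mat_vec mult_mat_vec)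
  then have "quad X (u + s \<cdot>\<^sub>v v) = (u + s \<cdot>\<^sub>v v) \<bullet> (X *\<^sub>v u + s \<cdot>\<^sub>v (X *\<^sub>v v))"
    by (simp add: quad_def)
  also have "\<dots> = u \<bullet> (X *\<^sub>v u + s \<cdot>\<^sub>v (X *\<^sub>v v)) + s * (v \<bullet> (X *\<^sub>v u + s \<cdot>\<^sub>v (X *\<^sub>v v)))"
    using Xu Xv u v by (subst add_scalar_prod_distrib[of _ m]) auto
  also have "\<dots> = u \<bullet> (X *\<^sub>v u) + s * (u \<bullet> (X *\<^sub>v v)) + s * (v \<bullet> (X *\<^sub>v u) + s * (v \<bullet> (X *\<^sub>v v)))"
    using Xu Xv u v by (simp add: scalar_prod_add_distrib[of _ m])
  finally show ?thesis
    by (simp add: quad_def power2_eq_square algebra_simps)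
qed

lemma quad_smult:
  assumes "X \<in> carrier_mat m m" "v \<in> carrier_vec m"
  shows "quad X (c \<cdot>\<^sub>v v) = c\<^sup>2 * quad X v"
  using assms by (simp add: quad_def mult_mat_vec power2_eq_square)

lemma quad_minus_smult:
  assumes "X \<in> carrier_mat m m" "Y \<in> carrier_mat m m" "v \<in> carrier_vec m"
  shows "quad (X - \<tau> \<cdot>\<^sub>m Y) v = quad X v - \<tau> * quad Y v"
proof -
  have Xv: "X *\<^sub>v v \<in> carrier_vec m" and Yv: "Y *\<^sub>v v \<in> carrier_vec m"
    using assms by auto
  have "(\<tau> \<cdot>\<^sub>m Y) *\<^sub>v v = \<tau> \<cdot>\<^sub>v (Y *\<^sub>v v)"
    using assms by (intro eq_vecI) auto
  then have "(X - \<tau> \<cdot>\<^sub>m Y) *\<^sub>v v = X *\<^sub>v v - \<tau> \<cdot>\<^sub>v (Y *\<^sub>v v)"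
    using assms by (subst minus_mult_distrib_mat_vec[of _ m m]) auto
  then show ?thesis
    using Xv Yv assms(3) by (simp add: quad_def scalar_prod_minus_distrib[of _ m])
qed

text \<open>The S-lemma on a line. The first polynomial has roots \<open>s\<^sub>1 < 0 < s\<^sub>2\<close>, where the second one is
  nonnegative; the convex combination of its two values in which the linear term cancels equals
  \<open>C - s\<^sub>1 s\<^sub>2 A\<close>, and \<open>s\<^sub>1 s\<^sub>2 = c / a\<close> by Vieta.\<close>

lemma quadratic_between_roots:
  fixes a b c A B C :: real
  assumes "a > 0" "c < 0" and imp: "\<And>s. a * s\<^sup>2 + b * s + c \<ge> 0 \<Longrightarrow> A * s\<^sup>2 + B * s + C \<ge> 0"
  shows "c * A \<le> C * a"
proof -
  define D where "D = sqrt (b\<^sup>2 - 4 * a * c)"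
  have "b\<^sup>2 < b\<^sup>2 - 4 * a * c"
    using assms(1,2) by (simp add: mult_pos_neg)
  then have "\<bar>b\<bar> < D"
    unfolding D_def by (metis real_sqrt_abs real_sqrt_less_iff)
  have D2: "D * D = b * b - 4 * a * c"
    unfolding D_def using \<open>b\<^sup>2 < _\<close> zero_le_power2[of b]
    by (metis abs_of_nonneg less_eq_real_def order_trans power2_eq_square real_sqrt_mult_self)
  define s1 s2 where "s1 = (- b - D) / (2 * a)" and "s2 = (- b + D) / (2 * a)"
  have "s1 < 0" "s2 > 0"
    using \<open>\<bar>b\<bar> < D\<close> \<open>a > 0\<close> by (auto simp: s1_def s2_def divide_neg_pos)
  have e: "2 * a * s1 = - b - D" "2 * a * s2 = - b + D"
    using \<open>a > 0\<close> by (auto simp: s1_def s2_def)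
  have "4 * a * (a * s1 * s2) = (2 * a * s1) * (2 * a * s2)"
    by simp
  also have "\<dots> = (- b - D) * (- b + D)"
    by (simp only: e)
  also have "\<dots> = 4 * a * c"
    using D2 by (simp add: algebra_simps)
  finally have prod: "a * s1 * s2 = c"
    using \<open>a > 0\<close> by simp
  have sum: "b = - (a * (s1 + s2))"
    using e by (simp add: algebra_simps)
  have "a * s1\<^sup>2 + b * s1 + c = 0" "a * s2\<^sup>2 + b * s2 + c = 0"
    unfolding prod[symmetric] sum by (simp_all add: power2_eq_square algebra_simps)
  then have r: "A * s1\<^sup>2 + B * s1 + C \<ge> 0" "A * s2\<^sup>2 + B * s2 + C \<ge> 0"
    using imp by (metis order_refl)+
  have "0 \<le> s2 * (A * s1\<^sup>2 + B * s1 + C) + (- s1) * (A * s2\<^sup>2 + B * s2 + C)"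
    using mult_nonneg_nonneg[OF _ r(1), of s2] mult_nonneg_nonneg[OF _ r(2), of "- s1"]
      \<open>s1 < 0\<close> \<open>s2 > 0\<close> by linarith
  also have "\<dots> = (s2 - s1) * (C - s1 * s2 * A)"
    by (simp add: algebra_simps power2_eq_square)
  finally have "0 \<le> C - s1 * s2 * A"
    using \<open>s1 < 0\<close> \<open>s2 > 0\<close> by (simp add: zero_le_mult_iff)
  then have "0 \<le> a * (C - s1 * s2 * A)"
    using \<open>a > 0\<close> by simp
  then show ?thesis
    by (simp add: algebra_simps flip: prod)
qed

text \<open>Passes from the open to the closed constraint at \<open>s = 0\<close>: in the direction in which \<open>b s \<ge> 0\<close>
  the first polynomial is positive arbitrarily close to \<open>0\<close>.\<close>

lemma nonneg_on_closure:
  fixes a b c A B C :: real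
  assumes "a > 0" "c \<ge> 0" and imp: "\<And>s. a * s\<^sup>2 + b * s + c > 0 \<Longrightarrow> A * s\<^sup>2 + B * s + C \<ge> 0"
  shows "C \<ge> 0"
proof -
  define \<sigma> :: real where "\<sigma> = (if b \<ge> 0 then 1 else - 1)"
  have pos: "A * (\<sigma> * s)\<^sup>2 + B * (\<sigma> * s) + C \<ge> 0" if "s > 0" for s
  proof (rule imp)
    have "a * (\<sigma> * s)\<^sup>2 > 0" "b * (\<sigma> * s) \<ge> 0"
      using that \<open>a > 0\<close> by (auto simp: \<sigma>_def mult_nonneg_nonneg mult_nonpos_nonneg)
    then show "0 < a * (\<sigma> * s)\<^sup>2 + b * (\<sigma> * s) + c"
      using \<open>c \<ge> 0\<close> by linarith
  qed
  have "((\<lambda>s. A * (\<sigma> * s)\<^sup>2 + B * (\<sigma> * s) + C) \<longlongrightarrow> A * (\<sigma> * 0)\<^sup>2 + B * (\<sigma> * 0) + C) (at_right 0)"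
    by (intro tendsto_intros)
  then have "A * (\<sigma> * 0)\<^sup>2 + B * (\<sigma> * 0) + C \<ge> 0"
    by (rule tendsto_lowerbound) (auto simp: eventually_at_right_less pos intro: eventually_mono[OF eventually_at_right_less])
  then show ?thesis by simp
qed

lemma transpose_minus_smult:
  assumes "X \<in> carrier_mat m m" "X\<^sup>T = X" "Y \<in> carrier_mat m m" "Y\<^sup>T = Y"
  shows "(X - \<tau> \<cdot>\<^sub>m Y)\<^sup>T = X - \<tau> \<cdot>\<^sub>m (Y :: real mat)"
proof -
  have "(\<tau> \<cdot>\<^sub>m Y)\<^sup>T = \<tau> \<cdot>\<^sub>m Y\<^sup>T"
    by (intro eq_matI) auto
  then show ?thesis
    using assms by (simp add: transpose_minus[of _ m m])
qed

text \<open>The multiplier has to separate the quotients \<open>X / Y\<close> of the two forms on \<open>{Y < 0}\<close>, which bound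
  it from below, from those on \<open>{Y > 0}\<close>, which bound it from above. Any quotient of the first kind is
  at most any of the second kind, because on the line through the two vectors \<open>Y\<close> is a quadratic
  polynomial with one root on each side (\<open>quadratic_between_roots\<close>). The infimum over \<open>{Y > 0}\<close> is
  a possible choice; it exists by Slater's condition and is nonnegative by assumption.\<close>

lemma S_lemma:
  assumes X: "X \<in> carrier_mat m m" "X\<^sup>T = X" and Y: "Y \<in> carrier_mat m m" "Y\<^sup>T = Y"
    and slater: "w \<in> carrier_vec m" "quad Y w > 0"
    and imp: "\<And>v. v \<in> carrier_vec m \<Longrightarrow> quad Y v > 0 \<Longrightarrow> quad X v \<ge> 0"
  shows "\<exists>\<tau>\<ge>0. psd m (X - \<tau> \<cdot>\<^sub>m Y)"
proof -
  have closed: "quad X v \<ge> 0" if v: "v \<in> carrier_vec m" and "quad Y v \<ge> 0" for v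
  proof (rule nonneg_on_closure[OF slater(2) that(2)])
    fix s assume "0 < quad Y w * s\<^sup>2 + (v \<bullet> (Y *\<^sub>v w) + w \<bullet> (Y *\<^sub>v v)) * s + quad Y v"
    then have "quad X (v + s \<cdot>\<^sub>v w) \<ge> 0"
      using slater v Y by (intro imp) (auto simp: quad_line)
    then show "0 \<le> quad X w * s\<^sup>2 + (v \<bullet> (X *\<^sub>v w) + w \<bullet> (X *\<^sub>v v)) * s + quad X v"
      using slater v X by (simp add: quad_line)
  qed
  have cross: "quad Y u * quad X v \<le> quad X u * quad Y v"
    if uv: "u \<in> carrier_vec m" "v \<in> carrier_vec m" and "quad Y u < 0" "quad Y v > 0" for u v
  proof (rule quadratic_between_roots[OF that(4,3)])
    fix s assume "0 \<le> quad Y v * s\<^sup>2 + (u \<bullet> (Y *\<^sub>v v) + v \<bullet> (Y *\<^sub>v u)) * s + quad Y u"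
    then have "quad X (u + s \<cdot>\<^sub>v v) \<ge> 0"
      using uv Y by (intro closed) (auto simp: quad_line)
    then show "0 \<le> quad X v * s\<^sup>2 + (u \<bullet> (X *\<^sub>v v) + v \<bullet> (X *\<^sub>v u)) * s + quad X u"
      using uv X by (simp add: quad_line)
  qed
  define R where "R = (\<lambda>v. quad X v / quad Y v) ` {v \<in> carrier_vec m. quad Y v > 0}"
  define \<tau> where "\<tau> = Inf R"
  have "R \<noteq> {}"
    using slater by (auto simp: R_def)
  have R0: "r \<ge> 0" if "r \<in> R" for r
    using that imp by (auto simp: R_def)
  have "\<tau> \<ge> 0"
    unfolding \<tau>_def using \<open>R \<noteq> {}\<close> R0 by (rule cInf_greatest)
  have "quad (X - \<tau> \<cdot>\<^sub>m Y) v \<ge> 0" if v: "v \<in> carrier_vec m" for v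
  proof -
    consider "quad Y v > 0" | "quad Y v = 0" | "quad Y v < 0" by linarith
    then have "\<tau> * quad Y v \<le> quad X v"
    proof cases
      case 1
      then have "\<tau> \<le> quad X v / quad Y v"
        unfolding \<tau>_def using v R0 by (intro cInf_lower bdd_belowI[of _ 0]) (auto simp: R_def)
      then show ?thesis using 1 by (simp add: field_simps)
    next
      case 2
      then show ?thesis using closed v by simp
    next
      case 3
      have "quad X v / quad Y v \<le> \<tau>"
        unfolding \<tau>_def
      proof (rule cInf_greatest[OF \<open>R \<noteq> {}\<close>])
        fix r assume "r \<in> R"
        then obtain w' where w': "w' \<in> carrier_vec m" "quad Y w' > 0" "r = quad X w' / quad Y w'"
          by (auto simp: R_def)
        then have "(r * quad Y v) * quad Y w' \<le> quad X v * quad Y w'"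
          using cross[OF v w'(1) 3 w'(2)] by (simp add: mult.commute)
        then have "r * quad Y v \<le> quad X v"
          using w'(2) by simp
        then show "quad X v / quad Y v \<le> r"
          using 3 by (simp add: divide_le_eq)
      qed
      then show ?thesis using 3 by (simp add: field_simps)
    qed
    then show ?thesis using X Y v by (simp add: quad_minus_smult)
  qed
  then have "psd m (X - \<tau> \<cdot>\<^sub>m Y)"
    using X Y by (auto simp: psd_def quad_def transpose_minus_smult[of _ m])
  with \<open>\<tau> \<ge> 0\<close> show ?thesis by blast
qed


section \<open>The linear matrix inequalities as distance bounds\<close>

lemma append_blocks:
  assumes "A \<in> carrier_mat n1 m1" "B \<in> carrier_mat n1 m2"
    and "C \<in> carrier_mat n2 m1" "D \<in> carrier_mat n2 m2"
  shows "(A @\<^sub>c B) @\<^sub>r (C @\<^sub>c D) = four_block_mat A B C D"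
  using assms by (intro eq_matI) (auto simp: append_cols_def append_rows_def)

lemma quad_four_block_mat:
  assumes "A \<in> carrier_mat n n" "B \<in> carrier_mat n m" "C \<in> carrier_mat m n" "D \<in> carrier_mat m m"
    and "x \<in> carrier_vec n" "z \<in> carrier_vec m"
  shows "quad (four_block_mat A B C D) (x @\<^sub>v z)
    = quad A x + x \<bullet> (B *\<^sub>v z) + z \<bullet> (C *\<^sub>v x) + quad D z"
proof -
  have c: "A *\<^sub>v x \<in> carrier_vec n" "B *\<^sub>v z \<in> carrier_vec n"
    "C *\<^sub>v x \<in> carrier_vec m" "D *\<^sub>v z \<in> carrier_vec m"
    using assms by auto
  have "quad (four_block_mat A B C D) (x @\<^sub>v z)
      = x \<bullet> (A *\<^sub>v x + B *\<^sub>v z) + z \<bullet> (C *\<^sub>v x + D *\<^sub>v z)"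
    using assms c
    by (simp add: quad_def four_block_mat_mult_vec[OF assms] scalar_prod_append[of _ n _ m])
  then show ?thesis
    using assms c by (simp add: quad_def scalar_prod_add_distrib[of _ n] scalar_prod_add_distrib[of _ m])
qed

text \<open>On the homogenization \<open>(x, z)\<close> of a point the quadratic form of \<open>dist_mat\<close> is
  \<open>|x - z \<xi>|\<^sup>2 - q z\<^sup>2\<close> and that of \<open>event_mat\<close> is \<open>x\<^sup>T S x - z\<^sup>2\<close>, so that a sample inequality
  is exactly what the S-lemma delivers for this pair.\<close>

definition dist_mat :: "nat \<Rightarrow> real vec \<Rightarrow> real \<Rightarrow> real mat" where
  "dist_mat n \<xi> q = (1\<^sub>m n @\<^sub>c - mat_of_cols n [\<xi>]) @\<^sub>r
     (- mat_of_rows n [\<xi>] @\<^sub>c scalar_mat (\<xi> \<bullet> \<xi> - q))"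

definition event_mat :: "nat \<Rightarrow> real mat \<Rightarrow> real mat" where
  "event_mat n S = (S @\<^sub>c 0\<^sub>m n 1) @\<^sub>r (0\<^sub>m 1 n @\<^sub>c scalar_mat (- 1))"

lemma sample_lmi_eq: "sample_lmi n \<xi> q \<tau> S \<longleftrightarrow> psd (n + 1) (dist_mat n \<xi> q - \<tau> \<cdot>\<^sub>m event_mat n S)"
  by (simp add: sample_lmi_def dist_mat_def event_mat_def)

definition homog :: "real vec \<Rightarrow> real \<Rightarrow> real vec" where
  "homog x z = x @\<^sub>v vec 1 (\<lambda>_. z)"

lemma homog_carrier [simp]: "x \<in> carrier_vec n \<Longrightarrow> homog x z \<in> carrier_vec (Suc n)"
  unfolding homog_def by (metis Suc_eq_plus1 append_carrier_vec vec_carrier)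

lemma homog_cases:
  assumes "v \<in> carrier_vec (Suc n)"
  obtains x z where "x \<in> carrier_vec n" "v = homog x z"
proof
  show "vec n (\<lambda>i. v $ i) \<in> carrier_vec n" by simp
  show "v = homog (vec n (\<lambda>i. v $ i)) (v $ n)"
    unfolding homog_def using assms by (intro eq_vecI) (auto simp: less_Suc_eq)
qed

lemma dist_mat_eq:
  "dist_mat n \<xi> q = four_block_mat (1\<^sub>m n) (mat n 1 (\<lambda>(i, j). - (\<xi> $ i)))
    (mat 1 n (\<lambda>(i, j). - (\<xi> $ j))) (scalar_mat (\<xi> \<bullet> \<xi> - q))"
proof -
  have "- mat_of_cols n [\<xi>] = mat n 1 (\<lambda>(i, j). - (\<xi> $ i))"
    unfolding mat_of_cols_def by (intro eq_matI) auto
  moreover have "- mat_of_rows n [\<xi>] = mat 1 n (\<lambda>(i, j). - (\<xi> $ j))"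
    unfolding mat_of_rows_def by (intro eq_matI) auto
  ultimately show ?thesis
    unfolding dist_mat_def by (simp only:) (intro append_blocks[of _ n n _ 1 _ 1]; simp)
qed

lemma event_mat_eq:
  "S \<in> carrier_mat n n \<Longrightarrow> event_mat n S = four_block_mat S (0\<^sub>m n 1) (0\<^sub>m 1 n) (scalar_mat (- 1))"
  unfolding event_mat_def by (rule append_blocks) auto

lemma dist_mat_carrier:
  assumes "\<xi> \<in> carrier_vec n"
  shows "dist_mat n \<xi> q \<in> carrier_mat (Suc n) (Suc n)" "(dist_mat n \<xi> q)\<^sup>T = dist_mat n \<xi> q"
proof -
  show "dist_mat n \<xi> q \<in> carrier_mat (Suc n) (Suc n)"
  proof -
    have "dist_mat n \<xi> q \<in> carrier_mat (n + 1) (n + 1)"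
      unfolding dist_mat_eq by (rule four_block_carrier_mat[OF one_carrier_mat mat_carrier])
    then show ?thesis by simp
  qed
  show "(dist_mat n \<xi> q)\<^sup>T = dist_mat n \<xi> q"
    unfolding dist_mat_eq using assms by (intro eq_matI) auto
qed

lemma quad_dist_mat:
  assumes \<xi>: "\<xi> \<in> carrier_vec n" and x: "x \<in> carrier_vec n"
  shows "quad (dist_mat n \<xi> q) (homog x z) = (x - z \<cdot>\<^sub>v \<xi>) \<bullet> (x - z \<cdot>\<^sub>v \<xi>) - q * z\<^sup>2"
proof -
  have "mat n 1 (\<lambda>(i, j). - (\<xi> $ i)) *\<^sub>v vec 1 (\<lambda>_. z) = - z \<cdot>\<^sub>v \<xi>"
    using \<xi> by (intro eq_vecI) (auto simp: scalar_prod_def)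
  moreover have "mat 1 n (\<lambda>(i, j). - (\<xi> $ j)) *\<^sub>v x = vec 1 (\<lambda>_. - (\<xi> \<bullet> x))"
    using \<xi> x by (intro eq_vecI) (auto simp: scalar_prod_def sum_negf)
  moreover have "scalar_mat (\<xi> \<bullet> \<xi> - q) *\<^sub>v vec 1 (\<lambda>_. z) = vec 1 (\<lambda>_. (\<xi> \<bullet> \<xi> - q) * z)"
    by (intro eq_vecI) (auto simp: scalar_prod_def)
  ultimately have "quad (dist_mat n \<xi> q) (homog x z)
      = x \<bullet> x - z * (x \<bullet> \<xi>) - z * (\<xi> \<bullet> x) + z * ((\<xi> \<bullet> \<xi> - q) * z)"
    unfolding dist_mat_eq homog_def
      quad_four_block_mat[OF one_carrier_mat mat_carrier mat_carrier mat_carrier x vec_carrier]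
    using \<xi> x by (simp add: quad_def scalar_prod_def[of "vec _ _"])
  also have "x \<bullet> \<xi> = \<xi> \<bullet> x"
    using x \<xi> by (rule comm_scalar_prod)
  also have "x \<bullet> x - z * (\<xi> \<bullet> x) - z * (\<xi> \<bullet> x) + z * ((\<xi> \<bullet> \<xi> - q) * z)
     = (x - z \<cdot>\<^sub>v \<xi>) \<bullet> (x - z \<cdot>\<^sub>v \<xi>) - q * z\<^sup>2"
    using x \<xi> comm_scalar_prod[OF x \<xi>]
    by (simp add: minus_scalar_prod_distrib[of _ n] scalar_prod_minus_distrib[of _ n]
        power2_eq_square algebra_simps)
  finally show ?thesis .
qed

lemma event_mat_carrier:
  assumes S: "S \<in> carrier_mat n n" "S\<^sup>T = S"
  shows "event_mat n S \<in> carrier_mat (Suc n) (Suc n)" "(event_mat n S)\<^sup>T = event_mat n S"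
proof -
  note eq = event_mat_eq[OF S(1)]
  show "event_mat n S \<in> carrier_mat (Suc n) (Suc n)"
  proof -
    have "event_mat n S \<in> carrier_mat (n + 1) (n + 1)"
      unfolding eq by (rule four_block_carrier_mat[OF S(1) mat_carrier])
    then show ?thesis by simp
  qed
  have "S $$ (i, j) = S $$ (j, i)" if "i < n" "j < n" for i j
    using assms that by (metis carrier_matD index_transpose_mat(1))
  then show "(event_mat n S)\<^sup>T = event_mat n S"
    unfolding eq using assms by (intro eq_matI) auto
qed

lemma quad_event_mat:
  assumes S: "S \<in> carrier_mat n n" and x: "x \<in> carrier_vec n"
  shows "quad (event_mat n S) (homog x z) = quad S x - z\<^sup>2"
proof -
  note eq = event_mat_eq[OF S]
  have "scalar_mat (- 1) *\<^sub>v vec 1 (\<lambda>_. z) = vec 1 (\<lambda>_. - z)"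
    by (intro eq_vecI) (auto simp: scalar_prod_def)
  moreover have "0\<^sub>m n 1 *\<^sub>v vec 1 (\<lambda>_. z) = 0\<^sub>v n" "0\<^sub>m 1 n *\<^sub>v x = 0\<^sub>v 1"
    using x by auto
  ultimately show ?thesis
    unfolding eq homog_def
      quad_four_block_mat[OF S zero_carrier_mat zero_carrier_mat mat_carrier x vec_carrier]
    using S x by (simp add: quad_def power2_eq_square scalar_prod_def[of "vec _ _"])
qed

lemma sample_lmi_bound:
  assumes \<xi>: "\<xi> \<in> carrier_vec n" and S: "S \<in> carrier_mat n n" "S\<^sup>T = S"
    and lmi: "sample_lmi n \<xi> q \<tau> S" "\<tau> \<ge> 0" and x: "x \<in> carrier_vec n" "quad S x > 1"
  shows "q \<le> (x - \<xi>) \<bullet> (x - \<xi>)"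
proof -
  have "homog x 1 \<in> carrier_vec (n + 1)"
    using homog_carrier[OF x(1)] by simp
  with lmi(1) have "0 \<le> quad (dist_mat n \<xi> q - \<tau> \<cdot>\<^sub>m event_mat n S) (homog x 1)"
    unfolding sample_lmi_eq psd_def quad_def by blast
  also have "\<dots> = (x - \<xi>) \<bullet> (x - \<xi>) - q - \<tau> * (quad S x - 1)"
    using \<xi> S x dist_mat_carrier[OF \<xi>] event_mat_carrier[OF S]
    by (simp add: quad_minus_smult[of _ "Suc n"] quad_dist_mat quad_event_mat)
  finally show ?thesis
    using mult_nonneg_nonneg[of \<tau> "quad S x - 1"] lmi x by linarith
qed

text \<open>If the event is nonempty, one of its points, with last coordinate \<open>1\<close>, satisfies
  Slater's condition and the S-lemma applies. If it is empty, the form of \<open>S\<close> is nonpositive by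
  scaling, and \<open>\<tau> = q\<close> cancels the terms in \<open>z\<^sup>2\<close>.\<close>

lemma sample_lmi_complete:
  assumes \<xi>: "\<xi> \<in> carrier_vec n" and S: "S \<in> carrier_mat n n" "S\<^sup>T = S" and "q \<ge> 0"
    and far: "\<And>x. x \<in> carrier_vec n \<Longrightarrow> quad S x > 1 \<Longrightarrow> q \<le> (x - \<xi>) \<bullet> (x - \<xi>)"
  shows "\<exists>\<tau>\<ge>0. sample_lmi n \<xi> q \<tau> S"
proof (cases "\<exists>w\<in>carrier_vec n. quad S w > 1")
  case True
  then obtain w where w: "w \<in> carrier_vec n" "quad S w > 1" by blast
  have "\<exists>\<tau>\<ge>0. psd (Suc n) (dist_mat n \<xi> q - \<tau> \<cdot>\<^sub>m event_mat n S)"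
  proof (rule S_lemma[OF dist_mat_carrier[OF \<xi>] event_mat_carrier[OF S]])
    show "homog w 1 \<in> carrier_vec (Suc n)" using w(1) by (rule homog_carrier)
    show "quad (event_mat n S) (homog w 1) > 0" using S w by (simp add: quad_event_mat)
    fix v assume "v \<in> carrier_vec (Suc n)" and pos: "quad (event_mat n S) v > 0"
    then obtain x z where x: "x \<in> carrier_vec n" and v: "v = homog x z"
      by (metis homog_cases)
    have pos: "quad S x > z\<^sup>2"
      using pos v S x by (simp add: quad_event_mat)
    \<comment> \<open>Points at infinity (\<open>z = 0\<close>) satisfy the claim trivially; the others are scaled to \<open>z = 1\<close>.\<close>
    show "quad (dist_mat n \<xi> q) v \<ge> 0"
    proof (cases "z = 0")
      case True
      have "x - 0 \<cdot>\<^sub>v \<xi> = x" using x \<xi> by auto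
      then show ?thesis
        using True x \<xi> scalar_prod_self_nonneg[of x] by (simp add: v quad_dist_mat)
    next
      case False
      define y where "y = (1 / z) \<cdot>\<^sub>v x"
      have y: "y \<in> carrier_vec n" "x = z \<cdot>\<^sub>v y"
        using x False by (auto simp: y_def smult_smult_assoc)
      have "quad S y > 1"
        using pos False y S by (simp add: quad_smult)
      then have "q \<le> (y - \<xi>) \<bullet> (y - \<xi>)"
        using far y by blast
      then have "q * z\<^sup>2 \<le> z\<^sup>2 * ((y - \<xi>) \<bullet> (y - \<xi>))"
        by (subst mult.commute) (rule mult_left_mono, simp_all)
      also have "\<dots> = (z \<cdot>\<^sub>v (y - \<xi>)) \<bullet> (z \<cdot>\<^sub>v (y - \<xi>))"
        using y \<xi> by (simp add: power2_eq_square)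
      also have "z \<cdot>\<^sub>v (y - \<xi>) = x - z \<cdot>\<^sub>v \<xi>"
        using y \<xi> by (intro eq_vecI) (auto simp: algebra_simps)
      finally show ?thesis
        using x \<xi> by (simp add: v quad_dist_mat)
    qed
  qed
  then show ?thesis by (simp add: sample_lmi_eq)
next
  case False
  have nonpos: "quad S x \<le> 0" if x: "x \<in> carrier_vec n" for x
  proof (rule ccontr)
    assume "\<not> quad S x \<le> 0"
    then have "quad S (sqrt (2 / quad S x) \<cdot>\<^sub>v x) = 2"
      using S x by (simp add: quad_smult)
    moreover have "sqrt (2 / quad S x) \<cdot>\<^sub>v x \<in> carrier_vec n"
      using x by simp
    ultimately have "quad S (sqrt (2 / quad S x) \<cdot>\<^sub>v x) > 1 \<and> sqrt (2 / quad S x) \<cdot>\<^sub>v x \<in> carrier_vec n"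
      by simp
    then show False using False by blast
  qed
  have "psd (Suc n) (dist_mat n \<xi> q - q \<cdot>\<^sub>m event_mat n S)"
    unfolding psd_def
  proof (intro conjI ballI)
    note c = dist_mat_carrier[OF \<xi>, of q] event_mat_carrier[OF S]
    show "dist_mat n \<xi> q - q \<cdot>\<^sub>m event_mat n S \<in> carrier_mat (Suc n) (Suc n)"
      using c by auto
    show "(dist_mat n \<xi> q - q \<cdot>\<^sub>m event_mat n S)\<^sup>T = dist_mat n \<xi> q - q \<cdot>\<^sub>m event_mat n S"
      using c by (rule transpose_minus_smult)
    fix v :: "real vec" assume "v \<in> carrier_vec (Suc n)"
    then obtain x z where x: "x \<in> carrier_vec n" and v: "v = homog x z"
      by (metis homog_cases)
    have "0 \<le> (x - z \<cdot>\<^sub>v \<xi>) \<bullet> (x - z \<cdot>\<^sub>v \<xi>) - q * quad S x"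
      using nonpos[OF x] \<open>q \<ge> 0\<close> scalar_prod_self_nonneg[of "x - z \<cdot>\<^sub>v \<xi>"] mult_nonneg_nonpos[of q "quad S x"]
      by linarith
    also have "\<dots> = quad (dist_mat n \<xi> q - q \<cdot>\<^sub>m event_mat n S) v"
      using c x \<xi> S
      by (simp add: v quad_minus_smult[of _ "Suc n"] quad_dist_mat quad_event_mat algebra_simps)
    finally show "0 \<le> v \<bullet> ((dist_mat n \<xi> q - q \<cdot>\<^sub>m event_mat n S) *\<^sub>v v)"
      by (simp add: quad_def)
  qed
  with \<open>q \<ge> 0\<close> show ?thesis by (auto simp: sample_lmi_eq)
qed

lemma hyp_lmi_iff: "hyp_lmi q t \<longleftrightarrow> t\<^sup>2 \<le> q"
proof -
  have M: "mat_of_rows_list 2 [[q, t], [t, 1]] *\<^sub>v v = vec 2 (\<lambda>i. if i = 0 then q * v $ 0 + t * v $ 1 else t * v $ 0 + v $ 1)"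
    if "v \<in> carrier_vec 2" for v
    using that by (intro eq_vecI) (auto simp: mat_of_rows_list_def scalar_prod_def numeral_2_eq_2 less_Suc_eq)
  \<comment> \<open>Completing the square, with the Schur complement \<open>q - t\<^sup>2\<close> of the entry \<open>1\<close>.\<close>
  have quad: "v \<bullet> (mat_of_rows_list 2 [[q, t], [t, 1]] *\<^sub>v v) = (t * v $ 0 + v $ 1)\<^sup>2 + (q - t\<^sup>2) * (v $ 0)\<^sup>2"
    if "v \<in> carrier_vec 2" for v
    unfolding M[OF that] using that by (simp add: scalar_prod_def numeral_2_eq_2 algebra_simps power2_eq_square)
  have carrier: "mat_of_rows_list 2 [[q, t], [t, 1]] \<in> carrier_mat 2 2"
    by (simp add: mat_of_rows_list_def numeral_2_eq_2)
  have sym: "(mat_of_rows_list 2 [[q, t], [t, 1]])\<^sup>T = mat_of_rows_list 2 [[q, t], [t, 1]]"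
    by (intro eq_matI) (auto simp: mat_of_rows_list_def numeral_2_eq_2 less_Suc_eq)
  show ?thesis
  proof
    assume "hyp_lmi q t"
    then have "0 \<le> vec 2 (\<lambda>i. if i = 0 then 1 else - t) \<bullet>
       (mat_of_rows_list 2 [[q, t], [t, 1]] *\<^sub>v vec 2 (\<lambda>i. if i = 0 then 1 else - t))"
      unfolding hyp_lmi_def psd_def by (metis vec_carrier)
    then show "t\<^sup>2 \<le> q" by (simp add: quad)
  next
    assume "t\<^sup>2 \<le> q"
    then show "hyp_lmi q t"
      unfolding hyp_lmi_def psd_def using carrier sym by (simp add: quad)
  qed
qed


section \<open>Measurability on Euclidean space\<close>

lemma quad_eq_sum:
  assumes "S \<in> carrier_mat n n" "x \<in> carrier_vec n"
  shows "quad S x = (\<Sum>i<n. x $ i * (\<Sum>j<n. S $$ (i, j) * x $ j))"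
  using assms by (auto simp: quad_def scalar_prod_def lessThan_atLeast0 intro!: sum.cong)

lemma measurable_quad:
  assumes "S \<in> carrier_mat n n"
  shows "quad S \<in> borel_measurable (borel_vec n)"
proof -
  have "(\<lambda>x. \<Sum>i<n. x $ i * (\<Sum>j<n. S $$ (i, j) * x $ j)) \<in> borel_measurable (borel_vec n)"
    by (intro borel_measurable_sum borel_measurable_times borel_measurable_const measurable_borel_vec_nth) auto
  then show ?thesis
    by (rule measurable_cong[THEN iffD1, rotated]) (simp add: quad_eq_sum[OF assms])
qed

lemma measurable_euclid_dist [measurable]:
  "(\<lambda>p. euclid_norm (fst p - snd p)) \<in> borel_measurable (borel_vec n \<Otimes>\<^sub>M borel_vec n)"
proof -
  have "(\<lambda>p. sqrt (\<Sum>i<n. (fst p $ i - snd p $ i) * (fst p $ i - snd p $ i)))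
      \<in> borel_measurable (borel_vec n \<Otimes>\<^sub>M borel_vec n)"
    by (intro measurable_compose[OF _ borel_measurable_sqrt]
        borel_measurable_sum borel_measurable_times borel_measurable_diff
        measurable_compose[OF measurable_fst measurable_borel_vec_nth]
        measurable_compose[OF measurable_snd measurable_borel_vec_nth]) auto
  then show ?thesis
    by (rule measurable_cong[THEN iffD1, rotated])
      (auto simp: space_pair_measure euclid_norm_def scalar_prod_def lessThan_atLeast0)
qed

lemma singleton_borel_vec:
  assumes "a \<in> carrier_vec n"
  shows "{a} \<in> sets (borel_vec n)"
proof -
  have "{x \<in> space (borel_vec n). \<forall>i\<in>{..<n}. x $ i = a $ i} \<in> sets (borel_vec n)"
  proof (rule sets.sets_Collect_countable_All')
    show "countable {..<n}" by simp
    fix i assume "i \<in> {..<n}"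
    then have "(\<lambda>x. x $ i) -` {a $ i} \<inter> space (borel_vec n) \<in> sets (borel_vec n)"
      by (intro measurable_sets[OF measurable_borel_vec_nth]) auto
    then show "{x \<in> space (borel_vec n). x $ i = a $ i} \<in> sets (borel_vec n)"
      by (rule back_subst[of "\<lambda>A. A \<in> sets (borel_vec n)"]) auto
  qed
  also have "{x \<in> space (borel_vec n). \<forall>i\<in>{..<n}. x $ i = a $ i} = {a}"
    using assms by (auto intro!: eq_vecI)
  finally show ?thesis .
qed

lemma nn_integral_empirical:
  assumes "N \<ge> 1" and "\<And>i. i < N \<Longrightarrow> \<xi>s i \<in> carrier_vec n" and f: "f \<in> borel_measurable (borel_vec n)"
  shows "(\<integral>\<^sup>+x. f x \<partial>empirical n N \<xi>s) = (\<Sum>i<N. f (\<xi>s i)) / of_nat N"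
proof -
  have m: "\<xi>s \<in> measurable (uniform_count_measure {..<N}) (borel_vec n)"
    using assms(2)
    by (auto simp: measurable_def space_uniform_count_measure sets_uniform_count_measure)
  have "(\<integral>\<^sup>+x. f x \<partial>empirical n N \<xi>s) = (\<integral>\<^sup>+i. f (\<xi>s i) \<partial>uniform_count_measure {..<N})"
    unfolding empirical_def by (rule nn_integral_distr[OF m]) (use f in simp)
  also have "\<dots> = (\<Sum>i<N. f (\<xi>s i) * ennreal (1 / real N))"
    unfolding uniform_count_measure_def by (subst nn_integral_point_measure_finite) (auto simp: mult.commute)
  also have "\<dots> = (\<Sum>i<N. f (\<xi>s i)) / of_nat N"
    using assms(1) by (simp add: sum_distrib_right[symmetric] divide_ennreal_def ennreal_of_nat_eq_real_of_nat
        inverse_ennreal inverse_eq_divide)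
  finally show ?thesis .
qed


section \<open>Couplings with an empirical distribution\<close>

text \<open>Weak duality. The bound on \<open>l\<close>, read as \<open>l 1\<^sub>E(x) \<le> y + |x - x'|\<close> for the pair \<open>(x, x')\<close> with \<open>x'\<close>
  a sample, is integrated against the coupling: the marginals turn the left-hand side into
  \<open>l P(E)\<close> and the first summand on the right into the sample mean of \<open>y\<close>.\<close>

lemma coupling_bound:
  assumes N: "N \<ge> 1" and \<xi>s: "\<And>i. i < N \<Longrightarrow> \<xi>s i \<in> carrier_vec n"
    and Q: "Q \<in> couplings n P (empirical n N \<xi>s)" and E: "E \<in> sets (borel_vec n)"
    and y: "\<And>i. i < N \<Longrightarrow> y i \<ge> 0"
    and bound: "\<And>i x. i < N \<Longrightarrow> x \<in> E \<Longrightarrow> l \<le> y i + euclid_norm (x - \<xi>s i)"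
  shows "ennreal l * emeasure P E
    \<le> ennreal (1 / real N * (\<Sum>i<N. y i)) + (\<integral>\<^sup>+ (x, x'). ennreal (euclid_norm (x - x')) \<partial>Q)"
proof -
  let ?B = "borel_vec n"
  have setsQ: "sets Q = sets (?B \<Otimes>\<^sub>M ?B)" and P: "P = distr Q ?B fst"
    and emp: "empirical n N \<xi>s = distr Q ?B snd"
    using Q by (auto simp: couplings_def)
  have spaceQ: "space Q = carrier_vec n \<times> carrier_vec n"
    using sets_eq_imp_space_eq[OF setsQ] by (simp add: space_pair_measure)
  have mfst: "fst \<in> measurable Q ?B" and msnd: "snd \<in> measurable Q ?B"
    by (simp_all add: measurable_cong_sets[OF setsQ refl])
  have mdist: "(\<lambda>p. ennreal (euclid_norm (fst p - snd p))) \<in> borel_measurable Q"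
    using measurable_euclid_dist[of n] by (simp add: measurable_cong_sets[OF setsQ refl])
  \<comment> \<open>Samples may coincide, so \<open>y\<close> is not a function of the sample point. Its least value \<open>f\<close> over the
    indices of a point is one; the value \<open>\<infinity>\<close> elsewhere makes the bound hold on the whole product space.\<close>
  define g where "g i x = (if x = \<xi>s i then ennreal (y i) else \<infinity>)" for i x
  define f where "f x = (INF i\<in>{..<N}. g i x)" for x
  have "g i \<in> borel_measurable ?B" if "i < N" for i
  proof -
    have "{x \<in> space ?B. x = \<xi>s i} = {\<xi>s i}"
      using \<xi>s[OF that] by auto
    then show ?thesis
      unfolding g_def using singleton_borel_vec[OF \<xi>s[OF that]] by (intro measurable_If) auto
  qed
  then have mf: "f \<in> borel_measurable ?B"
    unfolding f_def by (intro borel_measurable_INF) auto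
  have "ennreal l * emeasure P E = (\<integral>\<^sup>+x. ennreal l * indicator E x \<partial>P)"
    using E by (simp add: nn_integral_cmult_indicator P)
  also have "\<dots> = (\<integral>\<^sup>+p. ennreal l * indicator E (fst p) \<partial>Q)"
    unfolding P using E by (intro nn_integral_distr[OF mfst]) auto
  also have "\<dots> \<le> (\<integral>\<^sup>+p. f (snd p) + ennreal (euclid_norm (fst p - snd p)) \<partial>Q)"
  proof (rule nn_integral_mono)
    fix p assume "p \<in> space Q"
    show "ennreal l * indicator E (fst p) \<le> f (snd p) + ennreal (euclid_norm (fst p - snd p))"
    proof (cases "fst p \<in> E")
      case True
      have "ennreal l - ennreal (euclid_norm (fst p - snd p)) \<le> f (snd p)"
        unfolding f_def
      proof (rule INF_greatest)
        fix i assume i: "i \<in> {..<N}"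
        show "ennreal l - ennreal (euclid_norm (fst p - snd p)) \<le> g i (snd p)"
        proof (cases "snd p = \<xi>s i")
          case True
          have "ennreal l \<le> ennreal (euclid_norm (fst p - snd p) + y i)"
            using bound[of i "fst p"] \<open>fst p \<in> E\<close> i True by (intro ennreal_leI) (auto simp: add.commute)
          also have "\<dots> = ennreal (euclid_norm (fst p - snd p)) + ennreal (y i)"
            using y i by (intro ennreal_plus) auto
          finally show ?thesis
            using True by (simp add: g_def ennreal_minus_le_iff)
        qed (simp add: g_def)
      qed
      then show ?thesis
        using True by (simp add: ennreal_minus_le_iff add.commute)
    qed simp
  qed
  also have "\<dots> = (\<integral>\<^sup>+p. f (snd p) \<partial>Q) + (\<integral>\<^sup>+p. ennreal (euclid_norm (fst p - snd p)) \<partial>Q)"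
    using measurable_compose[OF msnd mf] mdist by (rule nn_integral_add)
  also have "(\<integral>\<^sup>+p. f (snd p) \<partial>Q) = (\<integral>\<^sup>+x. f x \<partial>empirical n N \<xi>s)"
    unfolding emp by (rule nn_integral_distr[OF msnd, symmetric]) (use mf in simp)
  also have "\<dots> = (\<Sum>i<N. f (\<xi>s i)) / of_nat N"
    by (rule nn_integral_empirical[OF N \<xi>s mf])
  also have "(\<Sum>i<N. f (\<xi>s i)) \<le> (\<Sum>i<N. ennreal (y i))"
  proof (rule sum_mono)
    fix i assume "i \<in> {..<N}"
    then have "f (\<xi>s i) \<le> g i (\<xi>s i)" unfolding f_def by (rule INF_lower)
    then show "f (\<xi>s i) \<le> ennreal (y i)" by (simp add: g_def)
  qed
  also have "(\<Sum>i<N. ennreal (y i)) / of_nat N = ennreal (1 / real N * (\<Sum>i<N. y i))"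
  proof -
    have "(\<Sum>i<N. ennreal (y i)) = ennreal (\<Sum>i<N. y i)"
      using y by (intro sum_ennreal) auto
    moreover have "0 \<le> (\<Sum>i<N. y i)"
      using y by (intro sum_nonneg) auto
    ultimately show ?thesis
      using N by (simp add: divide_ennreal ennreal_of_nat_eq_real_of_nat)
  qed
  finally show ?thesis
    by (simp add: case_prod_unfold add_right_mono divide_right_mono_ennreal)
qed

text \<open>The distribution is the law of the following experiment: draw a sample index \<open>i\<close> uniformly and
  then, with probability \<open>w\<^sub>i\<close>, move from \<open>\<xi>\<^sub>i\<close> to the target \<open>z\<^sub>i\<close>. The pair of
  the final and the initial position is the coupling.\<close>

lemma transport_to_targets:
  assumes N: "N \<ge> 1" and \<xi>s: "\<And>i. i < N \<Longrightarrow> \<xi>s i \<in> carrier_vec n"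
    and z: "\<And>i. i < N \<Longrightarrow> z i \<in> carrier_vec n"
    and w: "\<And>i. 0 \<le> w i" "\<And>i. w i \<le> 1"
  obtains P where "P \<in> prob_measures n"
    and "wasserstein n P (empirical n N \<xi>s)
      \<le> ennreal (1 / real N * (\<Sum>i<N. w i * euclid_norm (z i - \<xi>s i)))"
    and "\<And>E. E \<in> sets (borel_vec n) \<Longrightarrow> (\<And>i. i < N \<Longrightarrow> z i \<in> E) \<Longrightarrow>
      ennreal (1 / real N * (\<Sum>i<N. w i)) \<le> emeasure P E"
proof -
  let ?B = "borel_vec n"
  define K where "K = bind_pmf (pmf_of_set {..<N}) (\<lambda>i. map_pmf (Pair i) (bernoulli_pmf (w i)))"
  have K: "(\<integral>\<^sup>+p. h p \<partial>K)
      = (\<Sum>i<N. h (i, True) * ennreal (w i) + h (i, False) * ennreal (1 - w i)) / of_nat N" for h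
    unfolding K_def using N w by (simp add: nn_integral_pmf_of_set lessThan_empty_iff)
  \<comment> \<open>Indices beyond the samples have probability zero, but the map \<open>T\<close> must send them into the
    carrier in order to be measurable.\<close>
  define c where "c i = (if i < N then i else 0)" for i
  define T where "T = (\<lambda>(i, b). (if b then z (c i) else \<xi>s (c i), \<xi>s (c i)))"
  have c: "c i < N" for i using N by (simp add: c_def)
  have T: "T \<in> measurable (measure_pmf K) (?B \<Otimes>\<^sub>M ?B)"
    using z[OF c] \<xi>s[OF c] by (auto simp: T_def space_pair_measure measurable_def)
  define Q where "Q = distr (measure_pmf K) (?B \<Otimes>\<^sub>M ?B) T"
  have intQ: "(\<integral>\<^sup>+p. h p \<partial>Q) = (\<Sum>i<N. h (z i, \<xi>s i) * ennreal (w i) + h (\<xi>s i, \<xi>s i) * ennreal (1 - w i)) / of_nat N"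
    if "h \<in> borel_measurable (?B \<Otimes>\<^sub>M ?B)" for h
  proof -
    have "(\<integral>\<^sup>+p. h p \<partial>Q) = (\<integral>\<^sup>+p. h (T p) \<partial>K)"
      unfolding Q_def by (rule nn_integral_distr[OF T]) (use that in simp)
    then show ?thesis by (simp add: K T_def c_def)
  qed
  interpret Q: prob_space Q
    unfolding Q_def by (rule prob_space.prob_space_distr[OF _ T]) (rule prob_space_measure_pmf)
  define P where "P = distr Q ?B fst"
  have setsQ: "sets Q = sets (?B \<Otimes>\<^sub>M ?B)" by (simp add: Q_def)
  have mfst: "fst \<in> measurable Q ?B" and msnd: "snd \<in> measurable Q ?B"
    by (simp_all add: measurable_cong_sets[OF setsQ refl])
  have "distr Q ?B snd = empirical n N \<xi>s"
  proof (rule measure_eqI)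
    fix A assume "A \<in> sets (distr Q ?B snd)"
    then have A: "A \<in> sets ?B" by simp
    have "emeasure (distr Q ?B snd) A = (\<integral>\<^sup>+x. indicator A x \<partial>distr Q ?B snd)"
      using A by simp
    also have "\<dots> = (\<integral>\<^sup>+p. indicator A (snd p) \<partial>Q)"
      using A by (intro nn_integral_distr[OF msnd]) auto
    also have "\<dots> = (\<Sum>i<N. indicator A (\<xi>s i) * ennreal (w i) + indicator A (\<xi>s i) * ennreal (1 - w i)) / of_nat N"
      using A by (subst intQ) auto
    also have "\<dots> = (\<Sum>i<N. indicator A (\<xi>s i)) / of_nat N"
      using w by (simp add: distrib_left[symmetric] ennreal_plus[symmetric] del: ennreal_plus)
    also have "\<dots> = (\<integral>\<^sup>+x. indicator A x \<partial>empirical n N \<xi>s)"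
      using A by (intro nn_integral_empirical[OF N \<xi>s, symmetric]) auto
    also have "\<dots> = emeasure (empirical n N \<xi>s) A"
      using A by (simp add: empirical_def)
    finally show "emeasure (distr Q ?B snd) A = emeasure (empirical n N \<xi>s) A" .
  qed (simp add: empirical_def)
  then have coupling: "Q \<in> couplings n P (empirical n N \<xi>s)"
    using Q.prob_space_axioms setsQ by (simp add: couplings_def P_def)
  have "wasserstein n P (empirical n N \<xi>s) \<le> (\<integral>\<^sup>+ (x, x'). ennreal (euclid_norm (x - x')) \<partial>Q)"
    unfolding wasserstein_def by (rule INF_lower[OF coupling])
  also have "\<dots> = (\<Sum>i<N. ennreal (euclid_norm (z i - \<xi>s i)) * ennreal (w i)) / of_nat N"
  proof -
    have "euclid_norm (\<xi>s i - \<xi>s i) = 0" if "i < N" for i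
      using \<xi>s[OF that] by (simp add: euclid_norm_def)
    then show ?thesis
      using measurable_euclid_dist[of n] by (simp add: case_prod_unfold intQ)
  qed
  also have "\<dots> = ennreal (1 / real N * (\<Sum>i<N. w i * euclid_norm (z i - \<xi>s i)))"
    using N w by (simp add: ennreal_mult''[symmetric] sum_nonneg divide_ennreal
        ennreal_of_nat_eq_real_of_nat mult.commute)
  finally have W: "wasserstein n P (empirical n N \<xi>s)
      \<le> ennreal (1 / real N * (\<Sum>i<N. w i * euclid_norm (z i - \<xi>s i)))" .
  have P: "P \<in> prob_measures n"
    unfolding prob_measures_def P_def using Q.prob_space_distr[OF mfst] by simp
  have "ennreal (1 / real N * (\<Sum>i<N. w i)) \<le> emeasure P E"
    if E: "E \<in> sets ?B" "\<And>i. i < N \<Longrightarrow> z i \<in> E" for E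
  proof -
    have "ennreal (1 / real N * (\<Sum>i<N. w i)) = (\<Sum>i<N. ennreal (w i)) / of_nat N"
      using N w by (simp add: sum_nonneg divide_ennreal ennreal_of_nat_eq_real_of_nat)
    also have "\<dots> \<le> (\<Sum>i<N. indicator E (z i) * ennreal (w i) + indicator E (\<xi>s i) * ennreal (1 - w i)) / of_nat N"
      using E by (intro divide_right_mono_ennreal sum_mono) auto
    also have "\<dots> = (\<integral>\<^sup>+p. indicator E (fst p) \<partial>Q)"
      using E by (subst intQ) auto
    also have "\<dots> = (\<integral>\<^sup>+x. indicator E x \<partial>P)"
      unfolding P_def using E by (intro nn_integral_distr[OF mfst, symmetric]) auto
    also have "\<dots> = emeasure P E"
      using E by (simp add: P_def)
    finally show ?thesis .
  qed
  with P W show thesis by (rule that)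
qed

text \<open>Strong duality for the fractional knapsack problem that maximizes the moved mass subject to the
  budget \<open>\<theta>\<close>, with unit costs \<open>d\<close>. The optimal multiplier is the \<open>\<epsilon>\<close>-quantile \<open>l\<close> of the
  costs: moving everything cheaper than \<open>l\<close> and, at cost \<open>l\<close>, just enough to reach the mass \<open>\<epsilon>\<close> costs
  \<open>l \<epsilon> - (1/N) \<Sum> max 0 (l - d\<^sub>i)\<close>, which \<open>dual\<close> puts below \<open>\<theta>\<close>. What is left of
  the budget pays for a little more mass than \<open>\<epsilon>\<close>.\<close>

lemma fractional_quantile:
  fixes d :: "nat \<Rightarrow> real"
  assumes N: "N \<ge> 1" and d: "\<And>i. i < N \<Longrightarrow> d i \<ge> 0" and \<epsilon>: "0 < \<epsilon>" "\<epsilon> < 1"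
    and dual: "\<And>l. l \<ge> 0 \<Longrightarrow> l * \<epsilon> < \<theta> + 1 / real N * (\<Sum>i<N. max 0 (l - d i))"
  obtains w where "\<And>i. 0 \<le> w i" "\<And>i. w i \<le> 1"
    and "\<epsilon> < 1 / real N * (\<Sum>i<N. w i)" and "1 / real N * (\<Sum>i<N. w i * d i) < \<theta>"
proof -
  define L where "L = {l \<in> d ` {..<N}. \<epsilon> * N < card {i. i < N \<and> d i \<le> l}}"
  define l where "l = Min L"
  have "finite L" by (simp add: L_def)
  have "d ` {..<N} \<noteq> {}" using N by (auto simp: lessThan_empty_iff)
  have "{i. i < N \<and> d i \<le> Max (d ` {..<N})} = {..<N}" by auto
  then have "Max (d ` {..<N}) \<in> L"
    using \<open>d ` {..<N} \<noteq> {}\<close> \<epsilon> N by (simp add: L_def)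
  then have "l \<in> L"
    unfolding l_def using \<open>finite L\<close> by (intro Min_in) auto
  then have l: "l \<in> d ` {..<N}" "\<epsilon> * N < card {i. i < N \<and> d i \<le> l}"
    by (auto simp: L_def)
  then have "l \<ge> 0" using d by auto
  define K0 K1 where "K0 = {i. i < N \<and> d i < l}" and "K1 = {i. i < N \<and> d i = l}"
  have fin: "finite K0" "finite K1" "K0 \<inter> K1 = {}" by (auto simp: K0_def K1_def)
  have sub: "K0 \<union> K1 \<subseteq> {..<N}" by (auto simp: K0_def K1_def)
  have "{i. i < N \<and> d i \<le> l} = K0 \<union> K1" by (auto simp: K0_def K1_def)
  then have above: "\<epsilon> * N < real (card K0) + real (card K1)"
    using l(2) fin by (simp add: card_Un_disjoint)
  have below: "real (card K0) \<le> \<epsilon> * N"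
  proof (cases "K0 = {}")
    case True
    then show ?thesis using \<epsilon>(1) by simp
  next
    case False
    define l' where "l' = Max (d ` K0)"
    have "l' \<in> d ` K0" unfolding l'_def using fin False by (intro Max_in) auto
    then have "l' < l" "l' \<in> d ` {..<N}" by (auto simp: K0_def)
    have "{i. i < N \<and> d i \<le> l'} = K0"
      using \<open>l' < l\<close> fin by (auto simp: K0_def l'_def)
    moreover have "l' \<notin> L"
      using \<open>l' < l\<close> Min_le[OF \<open>finite L\<close>, of l'] by (auto simp: l_def)
    ultimately show ?thesis
      using \<open>l' \<in> d ` {..<N}\<close> by (simp add: L_def)
  qed
  have "card K1 > 0" using above below by linarith
  define \<sigma> where "\<sigma> = \<theta> * N - (\<Sum>i\<in>K0. d i) - l * (\<epsilon> * N - card K0)"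
  have "(\<Sum>i<N. max 0 (l - d i)) = (\<Sum>i\<in>K0. l - d i)"
    by (rule sum.mono_neutral_cong_right) (auto simp: K0_def)
  also have "\<dots> = l * card K0 - (\<Sum>i\<in>K0. d i)"
    by (simp add: sum_subtractf)
  finally have "\<sigma> > 0"
    using dual[OF \<open>l \<ge> 0\<close>] N by (simp add: \<sigma>_def field_simps)
  \<comment> \<open>The extra mass is limited by what is available at cost \<open>l\<close> and by the unspent budget \<open>\<sigma>\<close>;
    the denominator \<open>l + 1\<close> keeps the expense strictly below \<open>\<sigma>\<close> and covers \<open>l = 0\<close>.\<close>
  define \<delta> where "\<delta> = min (card K0 + card K1 - \<epsilon> * N) (\<sigma> / (l + 1))"
  have \<delta>: "0 < \<delta>" "\<delta> \<le> card K0 + card K1 - \<epsilon> * N" "\<delta> \<le> \<sigma> / (l + 1)"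
    using above \<open>\<sigma> > 0\<close> \<open>l \<ge> 0\<close> by (auto simp: \<delta>_def)
  have "l * \<delta> < \<sigma>"
  proof -
    have "l * \<delta> < (l + 1) * \<delta>" using \<delta>(1) by (simp add: algebra_simps)
    also have "\<dots> \<le> \<sigma>" using \<delta>(3) \<open>l \<ge> 0\<close> by (simp add: field_simps)
    finally show ?thesis .
  qed
  define \<omega> where "\<omega> = (\<epsilon> * N - card K0 + \<delta>) / card K1"
  have \<omega>: "0 \<le> \<omega>" "\<omega> \<le> 1" "\<omega> * card K1 = \<epsilon> * N - card K0 + \<delta>"
    using below \<delta> \<open>card K1 > 0\<close> by (auto simp: \<omega>_def)
  define w where "w i = (if i \<in> K0 then 1 else if i \<in> K1 then \<omega> else 0)" for i
  have split: "(\<Sum>i<N. w i * h i) = (\<Sum>i\<in>K0. h i) + \<omega> * (\<Sum>i\<in>K1. h i)" for h :: "nat \<Rightarrow> real"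
  proof -
    have "(\<Sum>i<N. w i * h i) = (\<Sum>i\<in>K0 \<union> K1. w i * h i)"
      using sub by (intro sum.mono_neutral_right) (auto simp: w_def)
    also have "\<dots> = (\<Sum>i\<in>K0. w i * h i) + (\<Sum>i\<in>K1. w i * h i)"
      using fin by (intro sum.union_disjoint)
    also have "(\<Sum>i\<in>K0. w i * h i) = (\<Sum>i\<in>K0. h i)"
      by (intro sum.cong) (auto simp: w_def)
    also have "(\<Sum>i\<in>K1. w i * h i) = (\<Sum>i\<in>K1. \<omega> * h i)"
      using fin(3) by (intro sum.cong) (auto simp: w_def)
    finally show ?thesis by (simp add: sum_distrib_left)
  qed
  have "(\<Sum>i<N. w i) = card K0 + \<omega> * card K1"
    using split[of "\<lambda>_. 1"] by simp
  then have mass: "(\<Sum>i<N. w i) = \<epsilon> * N + \<delta>"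
    using \<omega>(3) by simp
  have "(\<Sum>i\<in>K1. d i) = l * card K1"
    by (simp add: K1_def)
  then have "(\<Sum>i<N. w i * d i) = (\<Sum>i\<in>K0. d i) + l * (\<omega> * card K1)"
    using split[of d] by simp
  also have "\<dots> = \<theta> * N - \<sigma> + l * \<delta>"
    unfolding \<omega>(3) by (simp add: \<sigma>_def algebra_simps)
  finally have cost: "(\<Sum>i<N. w i * d i) < \<theta> * N"
    using \<open>l * \<delta> < \<sigma>\<close> by linarith
  show thesis
  proof
    show "0 \<le> w i" "w i \<le> 1" for i using \<omega> by (auto simp: w_def)
    show "\<epsilon> < 1 / real N * (\<Sum>i<N. w i)" using mass \<delta>(1) N by (simp add: field_simps)
    show "1 / real N * (\<Sum>i<N. w i * d i) < \<theta>" using cost N by (simp add: field_simps)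
  qed
qed


section \<open>A single chance constraint\<close>

definition exceedance :: "nat \<Rightarrow> real mat \<Rightarrow> real vec set" where
  "exceedance n S = {\<xi> \<in> carrier_vec n. quad S \<xi> > 1}"

lemma worst_case_prob_le_iff:
  "worst_case_prob n \<theta> N \<xi>s S \<le> c \<longleftrightarrow>
    (\<forall>P \<in> wasserstein_ball n \<theta> N \<xi>s. emeasure P (exceedance n S) \<le> c)"
  by (simp add: worst_case_prob_def exceedance_def quad_def SUP_le_iff)

lemma exceedance_sets:
  assumes "S \<in> carrier_mat n n"
  shows "exceedance n S \<in> sets (borel_vec n)"
proof -
  have "{x \<in> space (borel_vec n). 1 < quad S x} \<in> sets (borel_vec n)"
    using measurable_quad[OF assms] by measurable
  then show ?thesis by (simp add: exceedance_def)
qed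

text \<open>The constraints of the semidefinite program that belong to one of its two chance constraints.\<close>

definition sdp_block :: "nat \<Rightarrow> real \<Rightarrow> nat \<Rightarrow> (nat \<Rightarrow> real vec) \<Rightarrow> real \<Rightarrow> real mat \<Rightarrow> real \<Rightarrow>
    (nat \<Rightarrow> real) \<Rightarrow> (nat \<Rightarrow> real) \<Rightarrow> (nat \<Rightarrow> real) \<Rightarrow> (nat \<Rightarrow> real) \<Rightarrow> bool" where
  "sdp_block n \<theta> N \<xi>s \<epsilon> S l y \<tau> t q \<longleftrightarrow>
     l \<ge> 0 \<and> \<theta> + 1 / real N * (\<Sum>i<N. y i) \<le> l * \<epsilon> \<and>
     (\<forall>i<N. y i \<ge> 0 \<and> \<tau> i \<ge> 0 \<and> y i \<ge> l - t i \<and> sample_lmi n (\<xi>s i) (q i) (\<tau> i) S \<and> hyp_lmi (q i) (t i))"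

text \<open>The assumption \<open>\<theta> > 0\<close> forces \<open>l > 0\<close> in the budget inequality, so that the bound on \<open>l P(E)\<close>
  from weak duality can be divided by \<open>l\<close>.\<close>

lemma sdp_block_imp_worst_case:
  assumes N: "N \<ge> 1" and \<xi>s: "\<And>i. i < N \<Longrightarrow> \<xi>s i \<in> carrier_vec n"
    and S: "S \<in> carrier_mat n n" "S\<^sup>T = S" and \<theta>: "\<theta> > 0"
    and blk: "sdp_block n \<theta> N \<xi>s \<epsilon> S l y \<tau> t q"
  shows "worst_case_prob n \<theta> N \<xi>s S \<le> ennreal \<epsilon>"
  unfolding worst_case_prob_le_iff
proof
  fix P assume "P \<in> wasserstein_ball n \<theta> N \<xi>s"
  then have P: "prob_space P" and W: "wasserstein n P (empirical n N \<xi>s) \<le> ennreal \<theta>"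
    by (auto simp: wasserstein_ball_def prob_measures_def)
  have "l \<ge> 0" and budget: "\<theta> + 1 / real N * (\<Sum>i<N. y i) \<le> l * \<epsilon>"
    and y: "\<And>i. i < N \<Longrightarrow> y i \<ge> 0"
    using blk by (auto simp: sdp_block_def)
  let ?E = "exceedance n S" and ?m = "1 / real N * (\<Sum>i<N. y i)"
  have "?m \<ge> 0" using y by (intro mult_nonneg_nonneg sum_nonneg) auto
  have "l > 0"
    using \<open>l \<ge> 0\<close> budget \<theta> \<open>?m \<ge> 0\<close> by (cases "l = 0") auto
  have far: "l \<le> y i + euclid_norm (x - \<xi>s i)" if "i < N" "x \<in> ?E" for i x
  proof -
    have i: "\<tau> i \<ge> 0" "y i \<ge> l - t i" "sample_lmi n (\<xi>s i) (q i) (\<tau> i) S" "(t i)\<^sup>2 \<le> q i"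
      using blk that by (auto simp: sdp_block_def hyp_lmi_iff)
    have "q i \<le> (x - \<xi>s i) \<bullet> (x - \<xi>s i)"
      using that by (intro sample_lmi_bound[OF \<xi>s[OF that(1)] S i(3,1)]) (auto simp: exceedance_def)
    with i(4) have "(t i)\<^sup>2 \<le> (euclid_norm (x - \<xi>s i))\<^sup>2"
      by (simp add: euclid_norm_square)
    then have "t i \<le> euclid_norm (x - \<xi>s i)"
      by (rule power2_le_imp_le) simp
    with i(2) show ?thesis by simp
  qed
  have "ennreal l * emeasure P ?E - ennreal ?m \<le> wasserstein n P (empirical n N \<xi>s)"
    unfolding wasserstein_def
  proof (rule INF_greatest)
    fix Q assume "Q \<in> couplings n P (empirical n N \<xi>s)"
    from coupling_bound[OF N \<xi>s this exceedance_sets[OF S(1)] y far]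
    show "ennreal l * emeasure P ?E - ennreal ?m
        \<le> (\<integral>\<^sup>+ (x, x'). ennreal (euclid_norm (x - x')) \<partial>Q)"
      by (simp add: ennreal_minus_le_iff)
  qed
  also note W
  finally have "ennreal l * emeasure P ?E \<le> ennreal ?m + ennreal \<theta>"
    by (simp add: ennreal_minus_le_iff)
  also have "\<dots> = ennreal (?m + \<theta>)"
    using \<open>?m \<ge> 0\<close> \<theta> by simp
  also have "\<dots> \<le> ennreal (l * \<epsilon>)"
    using budget by (intro ennreal_leI) simp
  finally have "ennreal l * emeasure P ?E \<le> ennreal l * ennreal \<epsilon>"
    using \<open>l \<ge> 0\<close> by (simp add: ennreal_mult')
  then show "emeasure P ?E \<le> ennreal \<epsilon>"
    using \<open>l > 0\<close> by (simp add: ennreal_mult_le_mult_iff)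
qed

text \<open>A multiplier \<open>l\<close> that satisfies the dual inequality with the distances \<open>d\<close> to the event yields
  the block, by completeness of the sample inequalities. If there were none, the fractional quantile
  weights would transport a mass above \<open>\<epsilon>\<close> into the event within the budget.\<close>

lemma worst_case_imp_sdp_block:
  assumes N: "N \<ge> 1" and \<xi>s: "\<And>i. i < N \<Longrightarrow> \<xi>s i \<in> carrier_vec n"
    and S: "S \<in> carrier_mat n n" "S\<^sup>T = S" and \<theta>: "\<theta> > 0" and \<epsilon>: "0 < \<epsilon>" "\<epsilon> < 1"
    and wc: "worst_case_prob n \<theta> N \<xi>s S \<le> ennreal \<epsilon>"
  shows "\<exists>l y \<tau> t q. sdp_block n \<theta> N \<xi>s \<epsilon> S l y \<tau> t q" (is ?goal)
proof -
  have reduce: "\<exists>l y \<tau> t q. sdp_block n \<theta> N \<xi>s \<epsilon> S l y \<tau> t q"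
    if "l \<ge> 0" and budget: "\<theta> + 1 / real N * (\<Sum>i<N. max 0 (l - d i)) \<le> l * \<epsilon>"
      and d: "\<And>i. i < N \<Longrightarrow> d i \<ge> 0"
      and le: "\<And>i x. i < N \<Longrightarrow> x \<in> exceedance n S \<Longrightarrow> d i \<le> euclid_norm (x - \<xi>s i)"
    for l d
  proof -
    have "\<exists>\<tau>\<ge>0. sample_lmi n (\<xi>s i) ((d i)\<^sup>2) \<tau> S" if i: "i < N" for i
    proof (rule sample_lmi_complete[OF \<xi>s[OF i] S])
      fix x assume "x \<in> carrier_vec n" "quad S x > 1"
      then have "d i \<le> euclid_norm (x - \<xi>s i)"
        using le i by (simp add: exceedance_def)
      then show "(d i)\<^sup>2 \<le> (x - \<xi>s i) \<bullet> (x - \<xi>s i)"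
        unfolding euclid_norm_square[symmetric] using d[OF i] by (rule power_mono)
    qed simp
    then obtain \<tau> where "\<And>i. i < N \<Longrightarrow> \<tau> i \<ge> 0 \<and> sample_lmi n (\<xi>s i) ((d i)\<^sup>2) (\<tau> i) S"
      by metis
    then have "sdp_block n \<theta> N \<xi>s \<epsilon> S l (\<lambda>i. max 0 (l - d i)) \<tau> d (\<lambda>i. (d i)\<^sup>2)"
      using that by (simp add: sdp_block_def hyp_lmi_iff)
    then show ?thesis by blast
  qed
  show ?thesis
  proof (cases "exceedance n S = {}")
    case True
    \<comment> \<open>Every distance bound holds for an empty event, so \<open>t\<close> may equal the multiplier, which makes
      all \<open>y\<close> vanish.\<close>
    show ?thesis
      by (rule reduce[of "\<theta> / \<epsilon>" "\<lambda>_. \<theta> / \<epsilon>"]) (use True \<theta> \<epsilon> in auto)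
  next
    case False
    define d where "d i = (INF x\<in>exceedance n S. euclid_norm (x - \<xi>s i))" for i
    have bdd: "bdd_below ((\<lambda>x. euclid_norm (x - \<xi>s i)) ` exceedance n S)" for i
      by (rule bdd_belowI2[of _ 0]) simp
    have d0: "d i \<ge> 0" for i
      unfolding d_def using False by (intro cINF_greatest) auto
    have dle: "d i \<le> euclid_norm (x - \<xi>s i)" if "x \<in> exceedance n S" for i x
      unfolding d_def using bdd that by (rule cINF_lower)
    show ?thesis
    proof (rule ccontr)
      assume none: "\<not> ?goal"
      have dual: "l * \<epsilon> < \<theta> + 1 / real N * (\<Sum>i<N. max 0 (l - d i))" if "l \<ge> 0" for l
      proof (rule ccontr)
        assume "\<not> ?thesis"
        then have "\<theta> + 1 / real N * (\<Sum>i<N. max 0 (l - d i)) \<le> l * \<epsilon>"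
          by (simp only: not_less)
        then have ?goal
          by (intro reduce[OF that]) (use d0 dle in auto)
        with none show False ..
      qed
      obtain w where w: "\<And>i. 0 \<le> w i" "\<And>i. w i \<le> 1"
        and mass: "\<epsilon> < 1 / real N * (\<Sum>i<N. w i)" and cost: "1 / real N * (\<Sum>i<N. w i * d i) < \<theta>"
        using fractional_quantile[OF N d0 \<epsilon> dual] by blast
      \<comment> \<open>The unspent budget \<open>\<eta>\<close> bounds how far the targets may miss the infimal distances.\<close>
      define \<eta> where "\<eta> = \<theta> - 1 / real N * (\<Sum>i<N. w i * d i)"
      have "\<eta> > 0" using cost by (simp add: \<eta>_def)
      have "\<exists>x\<in>exceedance n S. euclid_norm (x - \<xi>s i) < d i + \<eta>" for i
        using cINF_less_iff[OF False bdd, of i "d i + \<eta>"] \<open>\<eta> > 0\<close> by (simp add: d_def)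
      then obtain z where z: "\<And>i. z i \<in> exceedance n S" "\<And>i. euclid_norm (z i - \<xi>s i) < d i + \<eta>"
        by metis
      have zc: "z i \<in> carrier_vec n" for i
        using z(1) by (simp add: exceedance_def)
      obtain P where P: "P \<in> prob_measures n"
        "wasserstein n P (empirical n N \<xi>s) \<le> ennreal (1 / real N * (\<Sum>i<N. w i * euclid_norm (z i - \<xi>s i)))"
        "\<And>E. E \<in> sets (borel_vec n) \<Longrightarrow> (\<And>i. i < N \<Longrightarrow> z i \<in> E) \<Longrightarrow>
          ennreal (1 / real N * (\<Sum>i<N. w i)) \<le> emeasure P E"
        using transport_to_targets[where N = N and n = n and \<xi>s = \<xi>s and z = z and w = w, OF N \<xi>s zc w]
        by blast
      have mass_P: "ennreal (1 / real N * (\<Sum>i<N. w i)) \<le> emeasure P (exceedance n S)"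
        using exceedance_sets[OF S(1)] z(1) by (rule P(3))
      have "(\<Sum>i<N. w i * euclid_norm (z i - \<xi>s i)) \<le> (\<Sum>i<N. w i * d i + \<eta>)"
      proof (rule sum_mono)
        fix i
        have "w i * euclid_norm (z i - \<xi>s i) \<le> w i * (d i + \<eta>)"
          using w z(2)[of i] by (intro mult_left_mono) auto
        also have "\<dots> \<le> w i * d i + \<eta>"
          using w(2)[of i] \<open>\<eta> > 0\<close> by (simp add: distrib_left mult_left_le_one_le w(1))
        finally show "w i * euclid_norm (z i - \<xi>s i) \<le> w i * d i + \<eta>" .
      qed
      then have "1 / real N * (\<Sum>i<N. w i * euclid_norm (z i - \<xi>s i)) \<le> 1 / real N * ((\<Sum>i<N. w i * d i) + N * \<eta>)"
        by (intro mult_left_mono) (auto simp: sum.distrib)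
      also have "\<dots> = \<theta>"
        using N by (simp add: \<eta>_def field_simps)
      finally have "P \<in> wasserstein_ball n \<theta> N \<xi>s"
        using P(1,2) by (auto simp: wasserstein_ball_def intro: order_trans ennreal_leI)
      then have "emeasure P (exceedance n S) \<le> ennreal \<epsilon>"
        using wc by (simp add: worst_case_prob_le_iff)
      with mass_P have "ennreal (1 / real N * (\<Sum>i<N. w i)) \<le> ennreal \<epsilon>"
        by (rule order_trans)
      then show False
        using mass \<epsilon> by (simp add: ennreal_le_iff)
    qed
  qed
qed

lemma worst_case_prob_le_iff_sdp_block:
  assumes "N \<ge> 1" and "\<And>i. i < N \<Longrightarrow> \<xi>s i \<in> carrier_vec n"
    and "S \<in> carrier_mat n n" "S\<^sup>T = S" and "\<theta> > 0" and "0 < \<epsilon>" "\<epsilon> < 1"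
  shows "worst_case_prob n \<theta> N \<xi>s S \<le> ennreal \<epsilon> \<longleftrightarrow>
    (\<exists>l y \<tau> t q. sdp_block n \<theta> N \<xi>s \<epsilon> S l y \<tau> t q)"
proof
  show "\<exists>l y \<tau> t q. sdp_block n \<theta> N \<xi>s \<epsilon> S l y \<tau> t q" if "worst_case_prob n \<theta> N \<xi>s S \<le> ennreal \<epsilon>"
    using assms that by (intro worst_case_imp_sdp_block)
  show "worst_case_prob n \<theta> N \<xi>s S \<le> ennreal \<epsilon>" if "\<exists>l y \<tau> t q. sdp_block n \<theta> N \<xi>s \<epsilon> S l y \<tau> t q"
    using that sdp_block_imp_worst_case[of N \<xi>s n S \<theta> \<epsilon>, OF assms(1-5)] by blast
qed


section \<open>The detector design problem\<close>

lemma congruence_symmetric: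
  assumes W: "W \<in> carrier_mat r n" and P: "P \<in> carrier_mat r r" "P\<^sup>T = (P :: real mat)"
  shows "W\<^sup>T * P * W \<in> carrier_mat n n" "(W\<^sup>T * P * W)\<^sup>T = W\<^sup>T * P * W"
proof -
  have WP: "W\<^sup>T * P \<in> carrier_mat n r"
    using W P by simp
  then show "W\<^sup>T * P * W \<in> carrier_mat n n"
    using W by simp
  have "(W\<^sup>T * P * W)\<^sup>T = W\<^sup>T * (W\<^sup>T * P)\<^sup>T"
    using WP W by (rule transpose_mult)
  also have "(W\<^sup>T * P)\<^sup>T = P * W"
    using W P by (simp add: transpose_mult[of _ n r _ r])
  also have "W\<^sup>T * (P * W) = W\<^sup>T * P * W"
    using W P by (intro assoc_mult_mat[symmetric, of _ n r _ r _ n]) auto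
  finally show "(W\<^sup>T * P * W)\<^sup>T = W\<^sup>T * P * W" .
qed

text \<open>Given the shared constraints, membership in the two feasible sets is the conjunction of the two
  chance constraints and of the two blocks, respectively, and these are equivalent one by one.\<close>

lemma detector_design_exact_reformulation:
  assumes N: "N \<ge> 1" and \<xi>s: "\<And>i. i < N \<Longrightarrow> \<xi>s i \<in> carrier_vec (dim_col Wd)"
    and params: "\<theta> > 0" "0 < \<epsilon>" "\<epsilon> < 1" "0 < \<beta>" "\<beta> < 1"
  shows "exact_reformulation
           (dro_feasible \<theta> N \<xi>s \<epsilon> \<beta> \<alpha> Wa Wd Va As Bs) dro_objective
           (sdp_feasible \<theta> N \<xi>s \<epsilon> \<beta> \<alpha> Wa Wd Va As Bs) sdp_objective"
proof -
  let ?n = "dim_col Wd"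
  have "(P, Q, M, \<alpha>1, \<alpha>2) \<in> dro_feasible \<theta> N \<xi>s \<epsilon> \<beta> \<alpha> Wa Wd Va As Bs \<longleftrightarrow>
      (\<exists>z. ((P, Q, M, \<alpha>1, \<alpha>2), z) \<in> sdp_feasible \<theta> N \<xi>s \<epsilon> \<beta> \<alpha> Wa Wd Va As Bs)"
    for P Q M \<alpha>1 \<alpha>2
  proof (cases "pos_def (dim_row Wd) P \<and> pos_def ?n Q \<and> star_constraints \<alpha> As Bs Va Wa P Q M \<alpha>1 \<alpha>2")
    case True
    then have P: "P \<in> carrier_mat (dim_row Wd) (dim_row Wd)" "P\<^sup>T = P"
      and Q: "Q \<in> carrier_mat ?n ?n" "Q\<^sup>T = Q" and M: "pos_def (dim_row As) M"
      by (auto simp: pos_def_def star_constraints_def Let_def)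
    let ?S = "Wd\<^sup>T * P * Wd"
    have Wd: "Wd \<in> carrier_mat (dim_row Wd) ?n" by simp
    have S: "?S \<in> carrier_mat ?n ?n" "?S\<^sup>T = ?S"
      by (rule congruence_symmetric[OF Wd P])+
    have "(P, Q, M, \<alpha>1, \<alpha>2) \<in> dro_feasible \<theta> N \<xi>s \<epsilon> \<beta> \<alpha> Wa Wd Va As Bs \<longleftrightarrow>
        worst_case_prob ?n \<theta> N \<xi>s ?S \<le> ennreal \<epsilon> \<and> worst_case_prob ?n \<theta> N \<xi>s Q \<le> ennreal (1 - \<beta>)"
      using True M by (simp add: dro_feasible_def Let_def)
    also have "\<dots> \<longleftrightarrow> (\<exists>l y \<tau> t q. sdp_block ?n \<theta> N \<xi>s \<epsilon> ?S l y \<tau> t q) \<and>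
        (\<exists>\<gamma> v \<pi> u p. sdp_block ?n \<theta> N \<xi>s (1 - \<beta>) Q \<gamma> v \<pi> u p)"
      using params
      by (simp add: worst_case_prob_le_iff_sdp_block[OF N \<xi>s S] worst_case_prob_le_iff_sdp_block[OF N \<xi>s Q])
    also have "\<dots> \<longleftrightarrow> (\<exists>\<gamma> l y v \<tau> \<pi> t u p q.
        sdp_block ?n \<theta> N \<xi>s \<epsilon> ?S l y \<tau> t q \<and> sdp_block ?n \<theta> N \<xi>s (1 - \<beta>) Q \<gamma> v \<pi> u p)"
      by blast
    also have "\<dots> \<longleftrightarrow> (\<exists>\<gamma> l y v \<tau> \<pi> t u p q.
        ((P, Q, M, \<alpha>1, \<alpha>2), (\<gamma>, l, y, v, \<tau>, \<pi>, t, u, p, q)) \<in> sdp_feasible \<theta> N \<xi>s \<epsilon> \<beta> \<alpha> Wa Wd Va As Bs)"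
      using True
      by (intro ex_cong1) (auto simp: sdp_feasible_def sdp_block_def Let_def mult.commute)
    also have "\<dots> \<longleftrightarrow> (\<exists>z. ((P, Q, M, \<alpha>1, \<alpha>2), z) \<in> sdp_feasible \<theta> N \<xi>s \<epsilon> \<beta> \<alpha> Wa Wd Va As Bs)"
      by (simp only: split_paired_Ex)
    finally show ?thesis .
  next
    case False
    then show ?thesis
      by (auto simp: dro_feasible_def sdp_feasible_def Let_def)
  qed
  then show ?thesis
    unfolding exact_reformulation_def
    by (auto simp: dro_objective_def sdp_objective_def split: prod.splits)
qed

theorem theorem2:
  fixes nx ny nu nd nc s N :: nat
    and A B C Bd Dd Ba Da Ac Bc Cc Dc :: "real mat"
    and Gp Wd Wa Wa_pinv Ua La Va Va_bar A_bar As Bs_a Bs_d Bs :: "real mat"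
    and \<xi>s :: "nat \<Rightarrow> real vec"
    and \<theta> \<epsilon> \<beta> \<alpha> :: real
  assumes plant: "A \<in> carrier_mat nx nx" "B \<in> carrier_mat nx nu" "Bd \<in> carrier_mat nx nd"
      "C \<in> carrier_mat ny nx" "Dd \<in> carrier_mat ny nd"
    and obs: "observable A C" and ctrb: "controllable A B"
    and attack: "Ba \<in> carrier_mat nu (nu + ny)" "Da \<in> carrier_mat ny (nu + ny)"
    and controller: "Ac \<in> carrier_mat nc nc" "Bc \<in> carrier_mat nc ny"
      "Cc \<in> carrier_mat nu nc" "Dc \<in> carrier_mat nu ny"
    and s: "s \<ge> nx"
    and Gp: "Gp \<in> carrier_mat (s * ny - nx) (s * ny)" "full_row_rank Gp"
      "Gp * obs_mat s A C = 0\<^sub>m (s * ny - nx) nx"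
    and Wd: "Wd = Gp * toeplitz_mat s A Bd C Dd"
    and Wa: "Wa = Gp * toeplitz_mat s A (B * Ba) C Da" "full_row_rank Wa"
    and pinv: "is_moore_penrose Wa Wa_pinv"
    and svd: "is_svd Wa Ua La Va" "Va_bar = first_cols (s * ny - nx) Va"
    and A_bar: "A_bar = cl_A A B C Ac Bc Cc Dc"
    and As: "As = lifted_A s A_bar"
    and Bs: "Bs_a = lifted_B s A_bar (cl_Ba B Ba Da Bc Dc)"
      "Bs_d = lifted_B s A_bar (cl_Bd B Bd Dd Bc Dc)"
      "Bs = (Bs_a * Va_bar) @\<^sub>c (Bs_d - Bs_a * Wa_pinv * Wd)"
    and samples: "N \<ge> 1" "\<And>i. i < N \<Longrightarrow> \<xi>s i \<in> carrier_vec (s * nd)"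
    and params: "\<theta> > 0" "0 < \<epsilon>" "\<epsilon> < 1" "0 < \<beta>" "\<beta> < 1" "0 < \<alpha>" "\<alpha> < 1"
  shows "exact_reformulation
           (dro_feasible \<theta> N \<xi>s \<epsilon> \<beta> \<alpha> Wa Wd Va_bar As Bs) dro_objective
           (sdp_feasible \<theta> N \<xi>s \<epsilon> \<beta> \<alpha> Wa Wd Va_bar As Bs) sdp_objective"
proof (rule detector_design_exact_reformulation[OF samples(1) _ params(1-5)])
  have "dim_col Wd = s * nd"
    using plant(5) by (simp add: Wd toeplitz_mat_def block_mat_def)
  then show "\<xi>s i \<in> carrier_vec (dim_col Wd)" if "i < N" for i
    using samples(2)[OF that] by simp
qed

end
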